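(* The system of total differential equations (T) has at least one $(s_1,s_2)$-nonautonomous $(n-k_1,n-k_2)$-cylindricality $\mathbb R$-differentiable partial integral $f\colon(z,w)\mapsto f({}^sz,{}^kw)$ on $G'$ (of the form described in the context) if and only if there exist vector functions ${}^{s_1}\psi({}^sz,{}^kw)$, ${}^{s_2}\psi({}^sz,{}^kw)$, ${}^\lambda\varphi({}^sz,{}^kw)$ and functions $H_l$, $l=1,\dots,2m$, satisfying the functional system (E) and such that (i) the Pfaffian differential equation (P) has an integrating factor; (ii) the function $f\colon(z,w)\mapsto f({}^sz,{}^kw)$ is a general integral of the Pfaffian differential equation (P).
   Context: Setting. $G\subset\mathbb C^{m+n}$ is a domain with points $(z,w)$, $z=(z_1,\dots,z_m)$, $w=(w_1,\dots,w_n)$, and $G'\subset G$ is a subdomain. $\mathbb R$-differentiable means differentiable as a function of the real and imaginary parts of the variables (all higher derivatives that appear are assumed to exist); $\partial_{z_j},\partial_{\overline z_j},\partial_{w_\xi},\partial_{\overline w_\xi}$ are Wirtinger derivatives; bars over functions denote complex conjugation. System (T) is $$dw_\xi=\sum_{j=1}^m\bigl(X_{\xi j}(z,w)\,dz_j+X_{\xi,m+j}(z,w)\,d\overline z_j\bigr),\quad \xi=1,\dots,n,\tag{T}$$ with $\mathbb R$-differentiable $X_{\xi l}\colon G\to\mathbb C$. Put, for $j=1,\dots,m$, $\mathfrak X_j=\partial_{z_j}+\sum_{\xi=1}^n(X_{\xi j}\partial_{w_\xi}+\overline X_{\xi,m+j}\partial_{\overline w_\xi})$ and $\mathfrak X_{m+j}=\partial_{\overline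 z_j}+\sum_{\xi=1}^n(X_{\xi,m+j}\partial_{w_\xi}+\overline X_{\xi j}\partial_{\overline w_\xi})$. A (non-constant) $\mathbb R$-differentiable function $f\colon G'\to\mathbb C$ is a partial integral of (T) if $\mathfrak X_lf(z,w)=\Phi_l(f;z,w)$ on $G'$ with $\Phi_l(0;z,w)\equiv0$, $l=1,\dots,2m$. A notation such as $\Phi(f;z,w)$ means a function depending on the value $f$ and on $(z,w)$; $\Phi(0;z,w)\equiv0$ means that it vanishes wherever $f=0$. Form of the functions. Fix integers $0\le s_1,s_2\le m$, $0\le k_1,k_2\le n$, a permutation $(j_1,\dots,j_m)$ of $(1,\dots,m)$ and a permutation $(\zeta_1,\dots,\zeta_n)$ of $(1,\dots,n)$. A function of the form $f({}^sz,{}^kw)$ is an $\mathbb R$-differentiable function on $G'$ that is antiholomorphic in $z_{s_1+1},\dots,z_m,w_{k_1+1},\dots,w_n$ and holomorphic in $z_{j_{s_2+1}},\dots,z_{j_m},w_{\zeta_{k_2+1}},\dots,w_{\zeta_n}$, i.e. $\partial_\chi f=0$ for every $\chi$ in the list $$\mathcal V=\{z_\alpha\ (\alpha>s_1),\ \overline z_{j_\beta}\ (\beta>s_2),\ w_\gamma\ (\gamma>k_1),\ \overline w_{\zeta_\delta}\ (\delta>k_2)\}.$$ A partial integral of this form is called $(s_1,s_2)$-nonautonomous and $(n-k_1,n-k_2)$-cylindricality. Notation. $\lambda=k_1+k_2$; for $j=1,\dots,m$, $${}^\lambda X^j=(X_{1j},\dots,X_{k_1j},\overline X_{\zeta_1,m+j},\dots,\overline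 X_{\zeta_{k_2},m+j}),\quad {}^\lambda X^{m+j}=(X_{1,m+j},\dots,X_{k_1,m+j},\overline X_{\zeta_1j},\dots,\overline X_{\zeta_{k_2}j}).$$ The unknown vector functions, all of whose components have the form $\cdot({}^sz,{}^kw)$, are ${}^{s_1}\psi=(\psi^{(1)}_1,\dots,\psi^{(1)}_{s_1})$, ${}^{s_2}\psi=(\psi^{(2)}_1,\dots,\psi^{(2)}_{s_2})$, ${}^{k_1}\varphi=(\varphi^{(1)}_1,\dots,\varphi^{(1)}_{k_1})$, ${}^{k_2}\varphi=(\varphi^{(2)}_1,\dots,\varphi^{(2)}_{k_2})$, ${}^\lambda\varphi=({}^{k_1}\varphi,{}^{k_2}\varphi)$; $H_l=H_l(f;z,w)$ are $\mathbb R$-differentiable with $H_l(0;z,w)\equiv0$. With $a\cdot b=\sum a_ib_i$, system (E) on $G'$ is: for every $\chi\in\mathcal V$, $\psi^{(1)}_\theta+{}^\lambda\varphi\cdot{}^\lambda X^\theta=H_\theta$, ${}^\lambda\varphi\cdot\partial_\chi^p\,{}^\lambda X^\theta=\partial_\chi^pH_\theta$, $p=1,\dots,\lambda$, $\theta=1,\dots,s_1$; ${}^\lambda\varphi\cdot{}^\lambda X^\eta=H_\eta$, ${}^\lambda\varphi\cdot\partial_\chi^p\,{}^\lambda X^\eta=\partial_\chi^pH_\eta$, $p=1,\dots,\lambda-1$, $\eta=s_1+1,\dots,m$; $\psi^{(2)}_g+{}^\lambda\varphi\cdot{}^\lambda X^{m+j_g}=H_{m+j_g}$, ${}^\lambda\varphi\cdot\partial_\chi^p\,{}^\lambda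 X^{m+j_g}=\partial_\chi^pH_{m+j_g}$, $p=1,\dots,\lambda$, $g=1,\dots,s_2$; ${}^\lambda\varphi\cdot{}^\lambda X^{m+j_\nu}=H_{m+j_\nu}$, ${}^\lambda\varphi\cdot\partial_\chi^p\,{}^\lambda X^{m+j_\nu}=\partial_\chi^pH_{m+j_\nu}$, $p=1,\dots,\lambda-1$, $\nu=s_2+1,\dots,m$. The Pfaffian equation is $$\omega:=\sum_{\theta=1}^{s_1}\psi^{(1)}_\theta dz_\theta+\sum_{g=1}^{s_2}\psi^{(2)}_gd\overline z_{j_g}+\sum_{\xi=1}^{k_1}\varphi^{(1)}_\xi dw_\xi+\sum_{\tau=1}^{k_2}\varphi^{(2)}_\tau d\overline w_{\zeta_\tau}=0.\tag{P}$$ An integrating factor of (P) is a non-vanishing function $\mu({}^sz,{}^kw)$ such that $\mu\,\omega=df$ for some function $f({}^sz,{}^kw)$; such a (non-constant) $f$ is a general integral of (P). *)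

theory Defs
  imports "HOL-Analysis.Analysis" "HOL-Library.Extended_Nat"
begin

text \<open>
  Points \<open>(z, w)\<close> of \<open>\<complex>\<^sup>m\<^sup>+\<^sup>n\<close> are pairs of vectors over finite index types. Numberings
  \<open>zi\<close> of \<open>'m\<close> by \<open>{1..m}\<close> and \<open>wi\<close> of \<open>'n\<close> by \<open>{1..n}\<close> give sense to
  \<open>z\<^sub>1, \<dots>, z\<^sub>m\<close> and \<open>w\<^sub>1, \<dots>, w\<^sub>n\<close>. All families below are indexed from 1.
\<close>

type_synonym ('m, 'n) point = "(complex ^ 'm) \<times> (complex ^ 'n)"

datatype cvar = Z nat | Zbar nat | W nat | Wbar nat

fun dcoord :: "(nat \<Rightarrow> 'm::finite) \<Rightarrow> (nat \<Rightarrow> 'n::finite) \<Rightarrow> cvar \<Rightarrow> ('m, 'n) point \<Rightarrow> complex" where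
  "dcoord zi wi (Z j) v = fst v $ zi j"
| "dcoord zi wi (Zbar j) v = cnj (fst v $ zi j)"
| "dcoord zi wi (W i) v = snd v $ wi i"
| "dcoord zi wi (Wbar i) v = cnj (snd v $ wi i)"

text \<open>Wirtinger derivatives, as \<open>(\<partial>\<^sub>x \<mp> i \<partial>\<^sub>y) / 2\<close> in the respective complex coordinate.\<close>

fun wirtinger ::
    "(nat \<Rightarrow> 'm::finite) \<Rightarrow> (nat \<Rightarrow> 'n::finite) \<Rightarrow> cvar \<Rightarrow>
     (('m, 'n) point \<Rightarrow> complex) \<Rightarrow> ('m, 'n) point \<Rightarrow> complex" where
  "wirtinger zi wi (Z j) f p =
     (frechet_derivative f (at p) (axis (zi j) 1, 0)
      - \<i> * frechet_derivative f (at p) (axis (zi j) \<i>, 0)) / 2"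
| "wirtinger zi wi (Zbar j) f p =
     (frechet_derivative f (at p) (axis (zi j) 1, 0)
      + \<i> * frechet_derivative f (at p) (axis (zi j) \<i>, 0)) / 2"
| "wirtinger zi wi (W i) f p =
     (frechet_derivative f (at p) (0, axis (wi i) 1)
      - \<i> * frechet_derivative f (at p) (0, axis (wi i) \<i>)) / 2"
| "wirtinger zi wi (Wbar i) f p =
     (frechet_derivative f (at p) (0, axis (wi i) 1)
      + \<i> * frechet_derivative f (at p) (0, axis (wi i) \<i>)) / 2"

primrec times_differentiable ::
    "nat \<Rightarrow> 'a::real_normed_vector set \<Rightarrow> ('a \<Rightarrow> complex) \<Rightarrow> bool" where
  "times_differentiable 0 S f \<longleftrightarrow> True"
| "times_differentiable (Suc k) S f \<longleftrightarrow>
     (\<forall>p\<in>S. f differentiable (at p)) \<and>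
     (\<forall>v. times_differentiable k S (\<lambda>p. frechet_derivative f (at p) v))"

text \<open>
  Real differentiability up to order \<open>r\<close>, where \<open>r = \<infinity>\<close> means all orders. The convention that
  all higher derivatives that appear exist is made precise as follows: the coefficients of (T), the
  unknowns \<open>\<psi>\<close>, \<open>\<phi>\<close>, \<open>H\<close> and the integrating factors have order \<open>r\<close>, and the partial
  integrals and general integrals, whose first derivatives play the role of \<open>\<psi>\<close> and \<open>\<phi>\<close>, have
  order \<open>r + 1\<close>. Here \<open>r\<close> is at least 1 and at least the highest order \<open>\<lambda>\<close> in (E).
\<close>

definition R_differentiable ::
    "enat \<Rightarrow> 'a::real_normed_vector set \<Rightarrow> ('a \<Rightarrow> complex) \<Rightarrow> bool" where
  "R_differentiable r S f \<longleftrightarrow> (\<forall>k. enat k \<le> r \<longrightarrow> times_differentiable k S f)"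

definition conj_index :: "nat \<Rightarrow> nat \<Rightarrow> nat" where
  "conj_index m l = (if l \<le> m then m + l else l - m)"

text \<open>The operator \<open>\<XX>\<^sub>l\<close>, \<open>l = 1, \<dots>, 2m\<close>.\<close>

definition op_X ::
    "nat \<Rightarrow> nat \<Rightarrow> (nat \<Rightarrow> 'm::finite) \<Rightarrow> (nat \<Rightarrow> 'n::finite) \<Rightarrow>
     (nat \<Rightarrow> nat \<Rightarrow> ('m, 'n) point \<Rightarrow> complex) \<Rightarrow> nat \<Rightarrow>
     (('m, 'n) point \<Rightarrow> complex) \<Rightarrow> ('m, 'n) point \<Rightarrow> complex" where
  "op_X m n zi wi X l f p =
     wirtinger zi wi (if l \<le> m then Z l else Zbar (l - m)) f p
     + (\<Sum>\<xi>=1..n. X \<xi> l p * wirtinger zi wi (W \<xi>) f p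
                  + cnj (X \<xi> (conj_index m l) p) * wirtinger zi wi (Wbar \<xi>) f p)"

text \<open>
  A function \<open>\<Phi>(f; z, w)\<close> is rendered as \<open>\<Phi> :: complex \<Rightarrow> point \<Rightarrow> complex\<close>, evaluated at
  \<open>\<Phi> (f p) p\<close>.
\<close>

definition partial_integral ::
    "nat \<Rightarrow> nat \<Rightarrow> (nat \<Rightarrow> 'm::finite) \<Rightarrow> (nat \<Rightarrow> 'n::finite) \<Rightarrow> enat \<Rightarrow>
     (nat \<Rightarrow> nat \<Rightarrow> ('m, 'n) point \<Rightarrow> complex) \<Rightarrow> ('m, 'n) point set \<Rightarrow>
     (('m, 'n) point \<Rightarrow> complex) \<Rightarrow> bool" where
  "partial_integral m n zi wi r X G' f \<longleftrightarrow>
     R_differentiable (r + 1) G' f \<and> \<not> f constant_on G' \<and>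
     (\<exists>\<Phi>. \<forall>l\<in>{1..2*m}. (\<forall>p\<in>G'. \<Phi> l 0 p = 0) \<and>
        (\<forall>p\<in>G'. op_X m n zi wi X l f p = \<Phi> l (f p) p))"

definition null_vars ::
    "nat \<Rightarrow> nat \<Rightarrow> nat \<Rightarrow> nat \<Rightarrow> nat \<Rightarrow> nat \<Rightarrow> (nat \<Rightarrow> nat) \<Rightarrow> (nat \<Rightarrow> nat) \<Rightarrow> cvar set" where
  "null_vars m n s1 s2 k1 k2 j \<zeta> =
     {Z \<alpha> | \<alpha>. s1 < \<alpha> \<and> \<alpha> \<le> m} \<union> {Zbar (j \<beta>) | \<beta>. s2 < \<beta> \<and> \<beta> \<le> m} \<union>
     {W \<gamma> | \<gamma>. k1 < \<gamma> \<and> \<gamma> \<le> n} \<union> {Wbar (\<zeta> \<delta>) | \<delta>. k2 < \<delta> \<and> \<delta> \<le> n}"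

text \<open>Functions of the form \<open>f(\<^sup>sz, \<^sup>kw)\<close>; \<open>V\<close> is the list of variables from \<open>null_vars\<close>.\<close>

definition of_form ::
    "(nat \<Rightarrow> 'm::finite) \<Rightarrow> (nat \<Rightarrow> 'n::finite) \<Rightarrow> enat \<Rightarrow> cvar set \<Rightarrow>
     ('m, 'n) point set \<Rightarrow> (('m, 'n) point \<Rightarrow> complex) \<Rightarrow> bool" where
  "of_form zi wi r V G' f \<longleftrightarrow>
     R_differentiable r G' f \<and> (\<forall>c\<in>V. \<forall>p\<in>G'. wirtinger zi wi c f p = 0)"

definition lam_X ::
    "nat \<Rightarrow> nat \<Rightarrow> (nat \<Rightarrow> nat) \<Rightarrow> (nat \<Rightarrow> nat \<Rightarrow> ('m, 'n) point \<Rightarrow> complex) \<Rightarrow>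
     nat \<Rightarrow> nat \<Rightarrow> ('m, 'n) point \<Rightarrow> complex" where
  "lam_X m k1 \<zeta> X l i =
     (if i \<le> k1 then X i l else (\<lambda>p. cnj (X (\<zeta> (i - k1)) (conj_index m l) p)))"

definition lam_phi ::
    "nat \<Rightarrow> (nat \<Rightarrow> ('m, 'n) point \<Rightarrow> complex) \<Rightarrow> (nat \<Rightarrow> ('m, 'n) point \<Rightarrow> complex) \<Rightarrow>
     nat \<Rightarrow> ('m, 'n) point \<Rightarrow> complex" where
  "lam_phi k1 \<phi>1 \<phi>2 i = (if i \<le> k1 then \<phi>1 i else \<phi>2 (i - k1))"

definition phi_dX ::
    "nat \<Rightarrow> (nat \<Rightarrow> 'm::finite) \<Rightarrow> (nat \<Rightarrow> 'n::finite) \<Rightarrow> nat \<Rightarrow> nat \<Rightarrow> (nat \<Rightarrow> nat) \<Rightarrow>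
     (nat \<Rightarrow> nat \<Rightarrow> ('m, 'n) point \<Rightarrow> complex) \<Rightarrow>
     (nat \<Rightarrow> ('m, 'n) point \<Rightarrow> complex) \<Rightarrow> (nat \<Rightarrow> ('m, 'n) point \<Rightarrow> complex) \<Rightarrow>
     cvar \<Rightarrow> nat \<Rightarrow> nat \<Rightarrow> ('m, 'n) point \<Rightarrow> complex" where
  "phi_dX m zi wi k1 k2 \<zeta> X \<phi>1 \<phi>2 c q l p =
     (\<Sum>i=1..k1+k2. lam_phi k1 \<phi>1 \<phi>2 i p * (wirtinger zi wi c ^^ q) (lam_X m k1 \<zeta> X l i) p)"

definition phi_X ::
    "nat \<Rightarrow> nat \<Rightarrow> nat \<Rightarrow> (nat \<Rightarrow> nat) \<Rightarrow>
     (nat \<Rightarrow> nat \<Rightarrow> ('m, 'n) point \<Rightarrow> complex) \<Rightarrow>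
     (nat \<Rightarrow> ('m, 'n) point \<Rightarrow> complex) \<Rightarrow> (nat \<Rightarrow> ('m, 'n) point \<Rightarrow> complex) \<Rightarrow>
     nat \<Rightarrow> ('m, 'n) point \<Rightarrow> complex" where
  "phi_X m k1 k2 \<zeta> X \<phi>1 \<phi>2 l p =
     (\<Sum>i=1..k1+k2. lam_phi k1 \<phi>1 \<phi>2 i p * lam_X m k1 \<zeta> X l i p)"

text \<open>
  System (E). Derivatives of \<open>H\<^sub>l\<close> are those of the function \<open>(z, w) \<mapsto> H\<^sub>l(f(z, w); z, w)\<close>. The
  equations without derivatives are imposed also when \<open>V\<close> is empty.
\<close>

definition system_E ::
    "nat \<Rightarrow> (nat \<Rightarrow> 'm::finite) \<Rightarrow> (nat \<Rightarrow> 'n::finite) \<Rightarrow>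
     (nat \<Rightarrow> nat \<Rightarrow> ('m, 'n) point \<Rightarrow> complex) \<Rightarrow> ('m, 'n) point set \<Rightarrow>
     nat \<Rightarrow> nat \<Rightarrow> nat \<Rightarrow> nat \<Rightarrow> (nat \<Rightarrow> nat) \<Rightarrow> (nat \<Rightarrow> nat) \<Rightarrow> cvar set \<Rightarrow>
     (nat \<Rightarrow> ('m, 'n) point \<Rightarrow> complex) \<Rightarrow> (nat \<Rightarrow> ('m, 'n) point \<Rightarrow> complex) \<Rightarrow>
     (nat \<Rightarrow> ('m, 'n) point \<Rightarrow> complex) \<Rightarrow> (nat \<Rightarrow> ('m, 'n) point \<Rightarrow> complex) \<Rightarrow>
     (nat \<Rightarrow> complex \<Rightarrow> ('m, 'n) point \<Rightarrow> complex) \<Rightarrow> (('m, 'n) point \<Rightarrow> complex) \<Rightarrow> bool" where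
  "system_E m zi wi X G' s1 s2 k1 k2 j \<zeta> V \<psi>1 \<psi>2 \<phi>1 \<phi>2 H f \<longleftrightarrow>
    (let A = phi_X m k1 k2 \<zeta> X \<phi>1 \<phi>2;
         dA = phi_dX m zi wi k1 k2 \<zeta> X \<phi>1 \<phi>2;
         h = (\<lambda>l p. H l (f p) p);
         dh = (\<lambda>c q l. (wirtinger zi wi c ^^ q) (h l));
         lam = k1 + k2
     in
      (\<forall>p\<in>G'.
        (\<forall>\<theta>\<in>{1..s1}. \<psi>1 \<theta> p + A \<theta> p = h \<theta> p \<and>
           (\<forall>c\<in>V. \<forall>q\<in>{1..lam}. dA c q \<theta> p = dh c q \<theta> p)) \<and>
        (\<forall>\<eta>\<in>{s1+1..m}. A \<eta> p = h \<eta> p \<and>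
           (\<forall>c\<in>V. \<forall>q\<in>{1..lam-1}. dA c q \<eta> p = dh c q \<eta> p)) \<and>
        (\<forall>g\<in>{1..s2}. \<psi>2 g p + A (m + j g) p = h (m + j g) p \<and>
           (\<forall>c\<in>V. \<forall>q\<in>{1..lam}. dA c q (m + j g) p = dh c q (m + j g) p)) \<and>
        (\<forall>\<nu>\<in>{s2+1..m}. A (m + j \<nu>) p = h (m + j \<nu>) p \<and>
           (\<forall>c\<in>V. \<forall>q\<in>{1..lam-1}. dA c q (m + j \<nu>) p = dh c q (m + j \<nu>) p))))"

definition admissible_unknowns ::
    "nat \<Rightarrow> (nat \<Rightarrow> 'm::finite) \<Rightarrow> (nat \<Rightarrow> 'n::finite) \<Rightarrow> enat \<Rightarrow> ('m, 'n) point set \<Rightarrow>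
     nat \<Rightarrow> nat \<Rightarrow> nat \<Rightarrow> nat \<Rightarrow> cvar set \<Rightarrow>
     (nat \<Rightarrow> ('m, 'n) point \<Rightarrow> complex) \<Rightarrow> (nat \<Rightarrow> ('m, 'n) point \<Rightarrow> complex) \<Rightarrow>
     (nat \<Rightarrow> ('m, 'n) point \<Rightarrow> complex) \<Rightarrow> (nat \<Rightarrow> ('m, 'n) point \<Rightarrow> complex) \<Rightarrow>
     (nat \<Rightarrow> complex \<Rightarrow> ('m, 'n) point \<Rightarrow> complex) \<Rightarrow> (('m, 'n) point \<Rightarrow> complex) \<Rightarrow> bool" where
  "admissible_unknowns m zi wi r G' s1 s2 k1 k2 V \<psi>1 \<psi>2 \<phi>1 \<phi>2 H f \<longleftrightarrow>
     (\<forall>\<theta>\<in>{1..s1}. of_form zi wi r V G' (\<psi>1 \<theta>)) \<and>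
     (\<forall>g\<in>{1..s2}. of_form zi wi r V G' (\<psi>2 g)) \<and>
     (\<forall>\<xi>\<in>{1..k1}. of_form zi wi r V G' (\<phi>1 \<xi>)) \<and>
     (\<forall>\<tau>\<in>{1..k2}. of_form zi wi r V G' (\<phi>2 \<tau>)) \<and>
     (\<forall>l\<in>{1..2*m}. R_differentiable r G' (\<lambda>p. H l (f p) p) \<and> (\<forall>p\<in>G'. H l 0 p = 0))"

text \<open>The Pfaffian form \<open>\<omega>\<close> at the point \<open>p\<close>, applied to the tangent vector \<open>v\<close>.\<close>

definition pfaff_form ::
    "(nat \<Rightarrow> 'm::finite) \<Rightarrow> (nat \<Rightarrow> 'n::finite) \<Rightarrow>
     nat \<Rightarrow> nat \<Rightarrow> nat \<Rightarrow> nat \<Rightarrow> (nat \<Rightarrow> nat) \<Rightarrow> (nat \<Rightarrow> nat) \<Rightarrow>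
     (nat \<Rightarrow> ('m, 'n) point \<Rightarrow> complex) \<Rightarrow> (nat \<Rightarrow> ('m, 'n) point \<Rightarrow> complex) \<Rightarrow>
     (nat \<Rightarrow> ('m, 'n) point \<Rightarrow> complex) \<Rightarrow> (nat \<Rightarrow> ('m, 'n) point \<Rightarrow> complex) \<Rightarrow>
     ('m, 'n) point \<Rightarrow> ('m, 'n) point \<Rightarrow> complex" where
  "pfaff_form zi wi s1 s2 k1 k2 j \<zeta> \<psi>1 \<psi>2 \<phi>1 \<phi>2 p v =
     (\<Sum>\<theta>=1..s1. \<psi>1 \<theta> p * dcoord zi wi (Z \<theta>) v)
     + (\<Sum>g=1..s2. \<psi>2 g p * dcoord zi wi (Zbar (j g)) v)
     + (\<Sum>\<xi>=1..k1. \<phi>1 \<xi> p * dcoord zi wi (W \<xi>) v)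
     + (\<Sum>\<tau>=1..k2. \<phi>2 \<tau> p * dcoord zi wi (Wbar (\<zeta> \<tau>)) v)"

text \<open>\<open>\<mu>\<close> is an integrating factor of \<open>\<omega> = 0\<close>, with \<open>\<mu> \<omega> = df\<close>.\<close>

definition integrates ::
    "(nat \<Rightarrow> 'm::finite) \<Rightarrow> (nat \<Rightarrow> 'n::finite) \<Rightarrow> enat \<Rightarrow> cvar set \<Rightarrow> ('m, 'n) point set \<Rightarrow>
     (('m, 'n) point \<Rightarrow> ('m, 'n) point \<Rightarrow> complex) \<Rightarrow>
     (('m, 'n) point \<Rightarrow> complex) \<Rightarrow> (('m, 'n) point \<Rightarrow> complex) \<Rightarrow> bool" where
  "integrates zi wi r V G' \<omega> \<mu> f \<longleftrightarrow>
     of_form zi wi r V G' \<mu> \<and> (\<forall>p\<in>G'. \<mu> p \<noteq> 0) \<and>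
     of_form zi wi (r + 1) V G' f \<and>
     (\<forall>p\<in>G'. (f has_derivative (\<lambda>v. \<mu> p * \<omega> p v)) (at p))"

definition integrating_factor ::
    "(nat \<Rightarrow> 'm::finite) \<Rightarrow> (nat \<Rightarrow> 'n::finite) \<Rightarrow> enat \<Rightarrow> cvar set \<Rightarrow> ('m, 'n) point set \<Rightarrow>
     (('m, 'n) point \<Rightarrow> ('m, 'n) point \<Rightarrow> complex) \<Rightarrow> (('m, 'n) point \<Rightarrow> complex) \<Rightarrow> bool" where
  "integrating_factor zi wi r V G' \<omega> \<mu> \<longleftrightarrow> (\<exists>f. integrates zi wi r V G' \<omega> \<mu> f)"

definition general_integral ::
    "(nat \<Rightarrow> 'm::finite) \<Rightarrow> (nat \<Rightarrow> 'n::finite) \<Rightarrow> enat \<Rightarrow> cvar set \<Rightarrow> ('m, 'n) point set \<Rightarrow>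
     (('m, 'n) point \<Rightarrow> ('m, 'n) point \<Rightarrow> complex) \<Rightarrow> (('m, 'n) point \<Rightarrow> complex) \<Rightarrow> bool" where
  "general_integral zi wi r V G' \<omega> f \<longleftrightarrow>
     \<not> f constant_on G' \<and> (\<exists>\<mu>. integrates zi wi r V G' \<omega> \<mu> f)"

end

theory Submission
  imports Defs
begin

text \<open>
  The equations of (E) are the equations \<open>\<XX>\<^sub>l f = \<Phi>\<^sub>l\<close>, rewritten for the Wirtinger derivatives of \<open>f\<close>
  and then differentiated along the variables in which \<open>f\<close> is holomorphic or antiholomorphic.

  Let \<open>f\<close> be a function of the given form. Its Wirtinger derivatives along \<open>\<V>\<close> vanish, so the sum
  defining \<open>\<XX>\<^sub>l f\<close> collapses to one base derivative plus \<open>\<^sup>\<lambda>\<phi> \<cdot> \<^sup>\<lambda>X\<^sup>l\<close>, where \<open>\<^sup>\<lambda>\<phi>\<close> collects the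
  remaining derivatives of \<open>f\<close> in \<open>w\<close> and in the conjugates of \<open>w\<close> (\<open>op_X_of_form\<close>). For the same
  reason \<open>df\<close> is a form of the shape (P) whose coefficients are the Wirtinger derivatives of \<open>f\<close>
  (\<open>has_derivative_of_form\<close>).

  If \<open>f\<close> is a partial integral, take these derivatives for \<open>\<psi>\<close> and \<open>\<phi>\<close> and put \<open>H\<^sub>l = \<Phi>\<^sub>l\<close>. Then
  \<open>\<omega> = df\<close>, the constant 1 is an integrating factor, and the equations of (E) without derivatives
  are the defining equations of \<open>f\<close>. Mixed second derivatives of \<open>f\<close> commute
  (\<open>symmetric_second_derivative\<close>), hence \<open>\<psi>\<close> and \<open>\<phi>\<close> are again annihilated by \<open>\<partial>\<^sub>\<chi>\<close> for
  \<open>\<chi> \<in> \<V>\<close> (\<open>of_form_wirtinger\<close>). They behave as constants under \<open>\<partial>\<^sub>\<chi>\<close>, so that applying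
  \<open>\<partial>\<^sub>\<chi>\<^sup>p\<close> to \<open>\<psi>\<^sub>l + \<^sup>\<lambda>\<phi> \<cdot> \<^sup>\<lambda>X\<^sup>l = H\<^sub>l\<close> gives the remaining equations
  (\<open>wirtinger_power_equation\<close>).

  Conversely, let \<open>\<mu> \<omega> = df\<close>. Comparing coefficients, the Wirtinger derivatives of \<open>f\<close> are \<open>\<mu>\<close> times
  the coefficients of \<open>\<omega>\<close>, and the underived equations of (E) yield \<open>\<XX>\<^sub>l f = \<mu> H\<^sub>l\<close>
  (\<open>op_X_of_integral\<close>). The right-hand side vanishes where \<open>f = 0\<close> because \<open>H\<^sub>l\<close> does, so \<open>f\<close> is a
  partial integral with \<open>\<Phi>\<^sub>l = \<mu> H\<^sub>l\<close>.
\<close>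

section \<open>Symmetry of second derivatives\<close>

text \<open>
  The second difference is the increment over \<open>[0, t]\<close> of \<open>s \<mapsto> f (x + s u + t v) - f (x + s u)\<close>. The
  derivative of this function of \<open>s\<close> is a difference of two values of \<open>p \<mapsto> f' p u\<close>, which the
  derivative \<open>L\<close> of that map at \<open>x\<close> approximates by \<open>t L v\<close> up to \<open>o(t)\<close>, uniformly in \<open>s\<close>. The mean
  value inequality then bounds the error by \<open>t \<cdot> o(t)\<close>.
\<close>

lemma second_difference_approximation:
  fixes f :: "'a::real_normed_vector \<Rightarrow> 'b::real_normed_vector"
  assumes S: "open S" "x \<in> S"
    and f: "\<And>p. p \<in> S \<Longrightarrow> (f has_derivative f' p) (at p)"
    and L: "((\<lambda>p. f' p u) has_derivative L) (at x)"
    and e: "e > 0"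
  shows "\<exists>d>0. \<forall>t. 0 < t \<and> t < d \<longrightarrow>
    norm (f (x + t *\<^sub>R u + t *\<^sub>R v) - f (x + t *\<^sub>R u) - f (x + t *\<^sub>R v) + f x - t\<^sup>2 *\<^sub>R L v) \<le> e * t\<^sup>2"
proof -
  define N where "N = norm u + norm v + 1"
  have N: "N > 0" "norm u + norm v \<le> N"
    by (simp_all add: N_def add_nonneg_pos)
  \<comment> \<open>The points in use lie within \<open>t N\<close> of \<open>x\<close>, and the linear approximation enters twice.\<close>
  define e' where "e' = e / (2 * N)"
  have e': "e' > 0" using e N by (simp add: e'_def)
  obtain d1 where d1: "d1 > 0"
    "\<And>y. norm (y - x) < d1 \<Longrightarrow> norm (f' y u - f' x u - L (y - x)) \<le> e' * norm (y - x)"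
    using L e' unfolding has_derivative_at_alt by meson
  obtain d2 where d2: "d2 > 0" "ball x d2 \<subseteq> S"
    using S open_contains_ball by metis
  define d where "d = min d1 d2 / N"
  have "d > 0" using d1 d2 N by (simp add: d_def)
  have lin: "linear L"
    using L has_derivative_linear by blast
  have main: "norm (f (x + t *\<^sub>R u + t *\<^sub>R v) - f (x + t *\<^sub>R u) - f (x + t *\<^sub>R v) + f x - t\<^sup>2 *\<^sub>R L v)
      \<le> e * t\<^sup>2" if t: "0 < t" "t < d" for t
  proof -
    have tN: "t * N < d1" "t * N < d2"
      using t N by (auto simp: d_def pos_less_divide_eq)
    have near: "norm (s *\<^sub>R u + c *\<^sub>R v) \<le> t * N"
      if "s \<in> {0..t}" "c \<in> {0..t}" for s c
    proof -
      have "norm (s *\<^sub>R u + c *\<^sub>R v) \<le> s * norm u + c * norm v"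
        using that norm_triangle_ineq[of "s *\<^sub>R u" "c *\<^sub>R v"] by simp
      also have "\<dots> \<le> t * norm u + t * norm v"
        using that by (intro add_mono mult_right_mono) auto
      also have "\<dots> \<le> t * N"
        using N t by (simp add: distrib_left[symmetric])
      finally show ?thesis .
    qed
    have inS: "x + s *\<^sub>R u + c *\<^sub>R v \<in> S" if "s \<in> {0..t}" "c \<in> {0..t}" for s c
    proof -
      have "dist x (x + s *\<^sub>R u + c *\<^sub>R v) = norm (s *\<^sub>R u + c *\<^sub>R v)"
        using norm_minus_cancel[of "s *\<^sub>R u + c *\<^sub>R v"] by (simp add: dist_norm)
      then have "dist x (x + s *\<^sub>R u + c *\<^sub>R v) < d2"
        using near[OF that] tN by linarith
      then show ?thesis using d2 by auto
    qed
    have lin_approx: "norm (f' (x + s *\<^sub>R u + c *\<^sub>R v) u - f' x u - L (s *\<^sub>R u + c *\<^sub>R v)) \<le> e' * (t * N)"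
      if "s \<in> {0..t}" "c \<in> {0..t}" for s c
    proof -
      have "norm (f' (x + s *\<^sub>R u + c *\<^sub>R v) u - f' x u - L (s *\<^sub>R u + c *\<^sub>R v))
          \<le> e' * norm (s *\<^sub>R u + c *\<^sub>R v)"
        using d1(2)[of "x + s *\<^sub>R u + c *\<^sub>R v"] near[OF that] tN by (simp add: add.assoc)
      also have "\<dots> \<le> e' * (t * N)"
        using near[OF that] e' by (intro mult_left_mono) auto
      finally show ?thesis .
    qed
    \<comment> \<open>Subtracting the expected linear growth leaves a function with derivative \<open>o(t)\<close>.\<close>
    define \<psi> where "\<psi> s = f (x + s *\<^sub>R u + t *\<^sub>R v) - f (x + s *\<^sub>R u) - s *\<^sub>R (t *\<^sub>R L v)" for s
    define \<psi>' where "\<psi>' s = f' (x + s *\<^sub>R u + t *\<^sub>R v) u - f' (x + s *\<^sub>R u) u - t *\<^sub>R L v" for s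
    have deriv: "(\<psi> has_derivative (\<lambda>h. h *\<^sub>R \<psi>' s)) (at s within {0..t})" if s: "s \<in> {0..t}" for s
    proof -
      have along: "((\<lambda>s. f (x + s *\<^sub>R u + c *\<^sub>R v)) has_derivative (\<lambda>h. h *\<^sub>R f' (x + s *\<^sub>R u + c *\<^sub>R v) u))
          (at s within {0..t})" if c: "c \<in> {0..t}" for c
      proof -
        have fs: "(f has_derivative f' (x + s *\<^sub>R u + c *\<^sub>R v)) (at (x + s *\<^sub>R u + c *\<^sub>R v))"
          using f inS[OF s c] by blast
        have "((\<lambda>s. x + s *\<^sub>R u + c *\<^sub>R v) has_derivative (\<lambda>h. h *\<^sub>R u)) (at s within {0..t})"
          by (auto intro!: derivative_eq_intros)
        from has_derivative_compose[OF this fs]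
        show ?thesis
          using linear_scale[OF has_derivative_linear[OF fs]] by simp
      qed
      have "((\<lambda>s. f (x + s *\<^sub>R u + t *\<^sub>R v) - f (x + s *\<^sub>R u + 0 *\<^sub>R v) - s *\<^sub>R (t *\<^sub>R L v)) has_derivative
          (\<lambda>h. h *\<^sub>R f' (x + s *\<^sub>R u + t *\<^sub>R v) u - h *\<^sub>R f' (x + s *\<^sub>R u + 0 *\<^sub>R v) u - h *\<^sub>R (t *\<^sub>R L v)))
          (at s within {0..t})"
        using t by (intro has_derivative_diff has_derivative_scaleR_left has_derivative_ident along) simp_all
      moreover have "\<psi> = (\<lambda>s. f (x + s *\<^sub>R u + t *\<^sub>R v) - f (x + s *\<^sub>R u + 0 *\<^sub>R v) - s *\<^sub>R (t *\<^sub>R L v))"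
        by (simp add: \<psi>_def fun_eq_iff)
      ultimately show ?thesis
        by (simp only: \<psi>'_def scaleR_diff_right scaleR_zero_left add_0_right)
    qed
    have small: "onorm (\<lambda>h. h *\<^sub>R \<psi>' s) \<le> e * t" if s: "s \<in> {0..t}" for s
    proof -
      have L: "L (s *\<^sub>R u + t *\<^sub>R v) - L (s *\<^sub>R u + 0 *\<^sub>R v) = t *\<^sub>R L v"
        by (simp add: linear_add[OF lin] linear_scale[OF lin])
      have "\<psi>' s = (f' (x + s *\<^sub>R u + t *\<^sub>R v) u - f' x u - L (s *\<^sub>R u + t *\<^sub>R v))
          - (f' (x + s *\<^sub>R u + 0 *\<^sub>R v) u - f' x u - L (s *\<^sub>R u + 0 *\<^sub>R v))"
        unfolding \<psi>'_def L[symmetric] by simp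
      then have "norm (\<psi>' s) \<le> e' * (t * N) + e' * (t * N)"
        by (simp only:) (rule order_trans[OF norm_triangle_ineq4 add_mono[OF lin_approx lin_approx]]; use s t in simp)
      also have "\<dots> = e * t" using N by (simp add: e'_def)
      finally show ?thesis
        by (simp add: onorm_scaleR_left onorm_id)
    qed
    have "norm (\<psi> t - \<psi> 0) \<le> (e * t) * norm (t - 0)"
      by (rule differentiable_bound[of "{0..t}"]) (use deriv small t in auto)
    moreover have "\<psi> t - \<psi> 0 = f (x + t *\<^sub>R u + t *\<^sub>R v) - f (x + t *\<^sub>R u) - f (x + t *\<^sub>R v) + f x - t\<^sup>2 *\<^sub>R L v"
      by (simp add: \<psi>_def power2_eq_square)
    ultimately show ?thesis
      using t by (simp add: power2_eq_square mult.assoc)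
  qed
  then show ?thesis using \<open>d > 0\<close> by blast
qed

text \<open>
  Young's form of the theorem, whose hypotheses are those that \<open>times_differentiable 2\<close> supplies. The
  second difference is symmetric in \<open>u\<close> and \<open>v\<close>, so \<open>t\<^sup>2 Lu v\<close> and \<open>t\<^sup>2 Lv u\<close> approximate the same
  quantity.
\<close>

lemma symmetric_second_derivative:
  fixes f :: "'a::real_normed_vector \<Rightarrow> 'b::real_normed_vector"
  assumes S: "open S" "x \<in> S"
    and f: "\<And>p. p \<in> S \<Longrightarrow> (f has_derivative f' p) (at p)"
    and Lu: "((\<lambda>p. f' p u) has_derivative Lu) (at x)"
    and Lv: "((\<lambda>p. f' p v) has_derivative Lv) (at x)"
  shows "Lu v = Lv u"
proof -
  have "norm (Lu v - Lv u) \<le> e" if e: "e > 0" for e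
  proof -
    obtain d1 where d1: "d1 > 0" "\<And>t. 0 < t \<and> t < d1 \<Longrightarrow>
        norm (f (x + t *\<^sub>R u + t *\<^sub>R v) - f (x + t *\<^sub>R u) - f (x + t *\<^sub>R v) + f x - t\<^sup>2 *\<^sub>R Lu v) \<le> e/2 * t\<^sup>2"
      using second_difference_approximation[OF S f Lu half_gt_zero[OF e], of v] by blast
    obtain d2 where d2: "d2 > 0" "\<And>t. 0 < t \<and> t < d2 \<Longrightarrow>
        norm (f (x + t *\<^sub>R v + t *\<^sub>R u) - f (x + t *\<^sub>R v) - f (x + t *\<^sub>R u) + f x - t\<^sup>2 *\<^sub>R Lv u) \<le> e/2 * t\<^sup>2"
      using second_difference_approximation[OF S f Lv half_gt_zero[OF e], of u] by blast
    define t where "t = min d1 d2 / 2"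
    have t: "0 < t" "t < d1" "t < d2" using d1(1) d2(1) by (auto simp: t_def)
    define D where "D = f (x + t *\<^sub>R u + t *\<^sub>R v) - f (x + t *\<^sub>R u) - f (x + t *\<^sub>R v) + f x"
    have D1: "norm (D - t\<^sup>2 *\<^sub>R Lu v) \<le> e/2 * t\<^sup>2"
      using d1(2)[of t] t unfolding D_def by blast
    have "D = f (x + t *\<^sub>R v + t *\<^sub>R u) - f (x + t *\<^sub>R v) - f (x + t *\<^sub>R u) + f x"
      by (simp add: D_def algebra_simps)
    then have D2: "norm (D - t\<^sup>2 *\<^sub>R Lv u) \<le> e/2 * t\<^sup>2"
      using d2(2)[of t] t by simp
    have "t\<^sup>2 * norm (Lu v - Lv u) = norm ((D - t\<^sup>2 *\<^sub>R Lv u) - (D - t\<^sup>2 *\<^sub>R Lu v))"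
      by (simp add: scaleR_diff_right[symmetric])
    also have "\<dots> \<le> e/2 * t\<^sup>2 + e/2 * t\<^sup>2"
      using norm_triangle_ineq4[of "D - t\<^sup>2 *\<^sub>R Lv u" "D - t\<^sup>2 *\<^sub>R Lu v"] D1 D2 by linarith
    also have "\<dots> = t\<^sup>2 * e" by simp
    finally show ?thesis using t by (simp add: mult_le_cancel_left)
  qed
  then have "norm (Lu v - Lv u) \<le> 0"
    by (rule field_le_epsilon) simp
  then show ?thesis by simp
qed

section \<open>Functions differentiable a given number of times\<close>

text \<open>
  Equations are only known on an open set \<open>S\<close>, whereas derivatives are taken of functions on the whole
  space. The congruence rules allow a function to be replaced by one that agrees with it on \<open>S\<close>,
  also under iterated derivatives.
\<close>

lemma has_derivative_cong_open:
  assumes "open S" "p \<in> S" "\<And>x. x \<in> S \<Longrightarrow> f x = g x"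
  shows "(f has_derivative D) (at p) \<longleftrightarrow> (g has_derivative D) (at p)"
  using assms by (metis has_derivative_transform_within_open)

lemma frechet_derivative_cong_open:
  assumes "open S" "p \<in> S" "\<And>x. x \<in> S \<Longrightarrow> f x = g x"
  shows "frechet_derivative f (at p) = frechet_derivative g (at p)"
  unfolding frechet_derivative_def using has_derivative_cong_open[OF assms] by simp

lemma times_differentiable_cong:
  assumes "open S" "\<And>x. x \<in> S \<Longrightarrow> f x = g x"
  shows "times_differentiable k S f \<longleftrightarrow> times_differentiable k S g"
  using assms(2)
proof (induction k arbitrary: f g)
  case (Suc k)
  have "f differentiable (at p) \<longleftrightarrow> g differentiable (at p)" if "p \<in> S" for p
    unfolding differentiable_def using has_derivative_cong_open[OF assms(1) that Suc.prems] by simp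
  moreover have "times_differentiable k S (\<lambda>p. frechet_derivative f (at p) v) \<longleftrightarrow>
      times_differentiable k S (\<lambda>p. frechet_derivative g (at p) v)" for v
    using frechet_derivative_cong_open[OF assms(1) _ Suc.prems] by (intro Suc.IH) simp
  ultimately show ?case by simp
qed simp

lemma times_differentiable_Suc_imp:
  "times_differentiable (Suc k) S f \<Longrightarrow> times_differentiable k S f"
proof (induction k arbitrary: f)
  case (Suc k)
  then show ?case using times_differentiable.simps(2) by blast
qed simp

lemma times_differentiable_SucD:
  assumes "times_differentiable (Suc k) S f"
  shows "p \<in> S \<Longrightarrow> f differentiable (at p)"
    and "times_differentiable k S (\<lambda>p. frechet_derivative f (at p) v)"
  using assms by simp_all

lemma times_differentiable_subset:
  "times_differentiable k S f \<Longrightarrow> T \<subseteq> S \<Longrightarrow> times_differentiable k T f"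
  by (induction k arbitrary: f) auto

lemma times_differentiable_const: "times_differentiable k S (\<lambda>_. c)"
  by (induction k arbitrary: c) auto

lemma frechet_derivative_bounded_linear_compose:
  assumes "bounded_linear h" "f differentiable (at p)"
  shows "frechet_derivative (\<lambda>x. h (f x)) (at p) v = h (frechet_derivative f (at p) v)"
    and "(\<lambda>x. h (f x)) differentiable (at p)"
proof -
  have "((\<lambda>x. h (f x)) has_derivative (\<lambda>v. h (frechet_derivative f (at p) v))) (at p)"
    using bounded_linear.has_derivative[OF assms(1)] assms(2) frechet_derivative_works by blast
  then show "frechet_derivative (\<lambda>x. h (f x)) (at p) v = h (frechet_derivative f (at p) v)"
    and "(\<lambda>x. h (f x)) differentiable (at p)"
    by (simp add: frechet_derivative_at[symmetric], auto simp: differentiable_def)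
qed

lemma times_differentiable_bounded_linear:
  assumes "open S" "bounded_linear h"
  shows "times_differentiable k S f \<Longrightarrow> times_differentiable k S (\<lambda>x. h (f x))"
proof (induction k arbitrary: f)
  case (Suc k)
  have "times_differentiable k S (\<lambda>p. frechet_derivative (\<lambda>x. h (f x)) (at p) v)" for v
  proof -
    have "times_differentiable k S (\<lambda>p. h (frechet_derivative f (at p) v))"
      using Suc by auto
    then show ?thesis
      using Suc.prems assms frechet_derivative_bounded_linear_compose(1)[OF assms(2)]
      by (subst times_differentiable_cong[OF assms(1)]) auto
  qed
  then show ?case
    using Suc.prems frechet_derivative_bounded_linear_compose(2)[OF assms(2)] by auto
qed simp

lemma frechet_derivative_add:
  fixes f g :: "'a::real_normed_vector \<Rightarrow> 'b::real_normed_vector"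
  assumes "f differentiable (at p)" "g differentiable (at p)"
  shows "frechet_derivative (\<lambda>x. f x + g x) (at p) v = frechet_derivative f (at p) v + frechet_derivative g (at p) v"
  using fun_cong[OF frechet_derivative_at[OF has_derivative_add[OF assms[unfolded frechet_derivative_works]]], of v] by simp

lemma frechet_derivative_mult:
  fixes f g :: "'a::real_normed_vector \<Rightarrow> 'b::real_normed_algebra"
  assumes "f differentiable (at p)" "g differentiable (at p)"
  shows "frechet_derivative (\<lambda>x. f x * g x) (at p) v
    = f p * frechet_derivative g (at p) v + frechet_derivative f (at p) v * g p"
  using fun_cong[OF frechet_derivative_at[OF has_derivative_mult[OF assms[unfolded frechet_derivative_works]]], of v] by simp

lemma times_differentiable_add:
  assumes "open S"
  shows "times_differentiable k S f \<Longrightarrow> times_differentiable k S g \<Longrightarrow> times_differentiable k S (\<lambda>x. f x + g x)"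
proof (induction k arbitrary: f g)
  case (Suc k)
  have "times_differentiable k S (\<lambda>p. frechet_derivative (\<lambda>x. f x + g x) (at p) v)" for v
  proof -
    have "times_differentiable k S (\<lambda>p. frechet_derivative f (at p) v + frechet_derivative g (at p) v)"
      using Suc by auto
    then show ?thesis
      using Suc.prems by (subst times_differentiable_cong[OF assms]) (auto simp: frechet_derivative_add)
  qed
  then show ?case using Suc.prems by auto
qed simp

lemma times_differentiable_mult:
  assumes "open S"
  shows "times_differentiable k S f \<Longrightarrow> times_differentiable k S g \<Longrightarrow> times_differentiable k S (\<lambda>x. f x * g x)"
proof (induction k arbitrary: f g)
  case (Suc k)
  have "times_differentiable k S (\<lambda>p. frechet_derivative (\<lambda>x. f x * g x) (at p) v)" for v
  proof -
    have "times_differentiable k S (\<lambda>p. f p * frechet_derivative g (at p) v + frechet_derivative f (at p) v * g p)"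
      using Suc.prems by (intro times_differentiable_add assms Suc.IH)
        (auto intro: times_differentiable_Suc_imp times_differentiable_SucD simp del: times_differentiable.simps)
    then show ?thesis
      using Suc.prems by (subst times_differentiable_cong[OF assms]) (auto simp: frechet_derivative_mult)
  qed
  then show ?case using Suc.prems by auto
qed simp

lemma times_differentiable_sum:
  assumes "open S" "\<And>i. i \<in> I \<Longrightarrow> times_differentiable k S (F i)"
  shows "times_differentiable k S (\<lambda>x. \<Sum>i\<in>I. F i x)"
  using assms(2)
  by (induction I rule: infinite_finite_induct)
     (auto simp: times_differentiable_const intro!: times_differentiable_add[OF assms(1)])

lemma R_differentiable_imp_differentiable:
  assumes "R_differentiable r S f" "1 \<le> r" "p \<in> S"
  shows "f differentiable (at p)"
proof -
  have "times_differentiable (Suc 0) S f"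
    using assms unfolding R_differentiable_def by (metis one_eSuc one_enat_def One_nat_def)
  then show ?thesis using assms by simp
qed

lemma R_differentiable_SucD:
  assumes "R_differentiable (r + 1) S f" "enat k \<le> r"
  shows "times_differentiable (Suc k) S f"
proof -
  have "enat (Suc k) \<le> r + 1" using assms(2) by (metis add_right_mono eSuc_enat plus_1_eSuc(2))
  then show ?thesis using assms(1) unfolding R_differentiable_def by blast
qed

lemma R_differentiable_cong:
  assumes "open S" "\<And>x. x \<in> S \<Longrightarrow> f x = g x"
  shows "R_differentiable r S f \<longleftrightarrow> R_differentiable r S g"
  using times_differentiable_cong[OF assms] by (simp add: R_differentiable_def)

lemma R_differentiable_add:
  "open S \<Longrightarrow> R_differentiable r S f \<Longrightarrow> R_differentiable r S g \<Longrightarrow> R_differentiable r S (\<lambda>x. f x + g x)"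
  by (simp add: R_differentiable_def times_differentiable_add)

lemma R_differentiable_mult:
  "open S \<Longrightarrow> R_differentiable r S f \<Longrightarrow> R_differentiable r S g \<Longrightarrow> R_differentiable r S (\<lambda>x. f x * g x)"
  by (simp add: R_differentiable_def times_differentiable_mult)

lemma R_differentiable_sum:
  "open S \<Longrightarrow> (\<And>i. i \<in> I \<Longrightarrow> R_differentiable r S (F i)) \<Longrightarrow> R_differentiable r S (\<lambda>x. \<Sum>i\<in>I. F i x)"
  by (simp add: R_differentiable_def times_differentiable_sum)

lemma R_differentiable_cnj:
  "open S \<Longrightarrow> R_differentiable r S f \<Longrightarrow> R_differentiable r S (\<lambda>x. cnj (f x))"
  by (simp add: R_differentiable_def times_differentiable_bounded_linear bounded_linear_cnj)

lemma R_differentiable_subset: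
  "R_differentiable r S f \<Longrightarrow> T \<subseteq> S \<Longrightarrow> R_differentiable r T f"
  by (auto simp: R_differentiable_def intro: times_differentiable_subset)

section \<open>Wirtinger derivatives\<close>

text \<open>
  All four kinds of Wirtinger derivatives have the shape \<open>(\<partial>\<^sub>a + \<epsilon> \<partial>\<^sub>b) / 2\<close> with real directions \<open>a\<close>,
  \<open>b\<close> and \<open>\<epsilon> = \<mp> \<i>\<close>. Naming these three ingredients allows the kinds to be treated uniformly.
\<close>

fun re_direction :: "(nat \<Rightarrow> 'm::finite) \<Rightarrow> (nat \<Rightarrow> 'n::finite) \<Rightarrow> cvar \<Rightarrow> ('m, 'n) point" where
  "re_direction zi wi (Z j) = (axis (zi j) 1, 0)"
| "re_direction zi wi (Zbar j) = (axis (zi j) 1, 0)"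
| "re_direction zi wi (W i) = (0, axis (wi i) 1)"
| "re_direction zi wi (Wbar i) = (0, axis (wi i) 1)"

fun im_direction :: "(nat \<Rightarrow> 'm::finite) \<Rightarrow> (nat \<Rightarrow> 'n::finite) \<Rightarrow> cvar \<Rightarrow> ('m, 'n) point" where
  "im_direction zi wi (Z j) = (axis (zi j) \<i>, 0)"
| "im_direction zi wi (Zbar j) = (axis (zi j) \<i>, 0)"
| "im_direction zi wi (W i) = (0, axis (wi i) \<i>)"
| "im_direction zi wi (Wbar i) = (0, axis (wi i) \<i>)"

fun im_coeff :: "cvar \<Rightarrow> complex" where
  "im_coeff (Z _) = - \<i>"
| "im_coeff (Zbar _) = \<i>"
| "im_coeff (W _) = - \<i>"
| "im_coeff (Wbar _) = \<i>"

lemma wirtinger_eq: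
  "wirtinger zi wi c f p =
    (frechet_derivative f (at p) (re_direction zi wi c)
     + im_coeff c * frechet_derivative f (at p) (im_direction zi wi c)) / 2"
  by (cases c) auto

declare wirtinger.simps [simp del]

lemma wirtinger_cong:
  assumes "open S" "p \<in> S" "\<And>x. x \<in> S \<Longrightarrow> f x = g x"
  shows "wirtinger zi wi c f p = wirtinger zi wi c g p"
  unfolding wirtinger_eq using frechet_derivative_cong_open[OF assms] by simp

lemma wirtinger_power_cong:
  assumes "open S" "\<And>x. x \<in> S \<Longrightarrow> f x = g x" "p \<in> S"
  shows "(wirtinger zi wi c ^^ q) f p = (wirtinger zi wi c ^^ q) g p"
  using assms(3)
proof (induction q arbitrary: p)
  case (Suc q)
  then show ?case by (auto intro: wirtinger_cong[OF assms(1)])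
qed (simp add: assms(2))

lemma wirtinger_const [simp]: "wirtinger zi wi c (\<lambda>_. a) p = 0"
  by (simp add: wirtinger_eq)

lemma wirtinger_add:
  assumes "f differentiable (at p)" "g differentiable (at p)"
  shows "wirtinger zi wi c (\<lambda>x. f x + g x) p = wirtinger zi wi c f p + wirtinger zi wi c g p"
  unfolding wirtinger_eq using assms by (simp add: frechet_derivative_add algebra_simps add_divide_distrib)

lemma wirtinger_mult:
  assumes "f differentiable (at p)" "g differentiable (at p)"
  shows "wirtinger zi wi c (\<lambda>x. f x * g x) p = f p * wirtinger zi wi c g p + wirtinger zi wi c f p * g p"
  unfolding wirtinger_eq using assms by (simp add: frechet_derivative_mult field_simps)

lemma wirtinger_sum:
  assumes "\<And>i. i \<in> I \<Longrightarrow> F i differentiable (at p)"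
  shows "wirtinger zi wi c (\<lambda>x. \<Sum>i\<in>I. F i x) p = (\<Sum>i\<in>I. wirtinger zi wi c (F i) p)"
  using assms
proof (induction I rule: infinite_finite_induct)
  case (insert i I)
  then show ?case
    using wirtinger_add[of "F i" p "\<lambda>x. \<Sum>i\<in>I. F i x"] by (simp add: differentiable_sum)
qed simp_all

lemma times_differentiable_wirtinger:
  assumes "open S" "times_differentiable (Suc k) S f"
  shows "times_differentiable k S (wirtinger zi wi c f)"
proof -
  have "times_differentiable k S (\<lambda>p. frechet_derivative f (at p) (re_direction zi wi c) * (1/2)
     + frechet_derivative f (at p) (im_direction zi wi c) * (im_coeff c / 2))"
    using assms(1) times_differentiable_SucD(2)[OF assms(2)]
    by (intro times_differentiable_add times_differentiable_mult times_differentiable_const)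
  then show ?thesis
    by (rule times_differentiable_cong[OF assms(1), THEN iffD1, rotated]) (simp add: wirtinger_eq field_simps)
qed

lemma times_differentiable_wirtinger_power:
  assumes "open S" "times_differentiable (q + k) S f"
  shows "times_differentiable k S ((wirtinger zi wi c ^^ q) f)"
  using assms(2)
proof (induction q arbitrary: k)
  case (Suc q)
  have "times_differentiable (Suc k) S ((wirtinger zi wi c ^^ q) f)"
    using Suc.prems by (intro Suc.IH) (simp del: times_differentiable.simps)
  then show ?case using times_differentiable_wirtinger[OF assms(1)] by simp
qed simp

lemma R_differentiable_wirtinger:
  assumes "open S" "R_differentiable (r + 1) S f"
  shows "R_differentiable r S (wirtinger zi wi c f)"
  using times_differentiable_wirtinger[OF assms(1) R_differentiable_SucD[OF assms(2)]]
  by (simp add: R_differentiable_def)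

lemma wirtinger_commute:
  assumes "open S" "times_differentiable 2 S f" "p \<in> S"
  shows "wirtinger zi wi c (wirtinger zi wi d f) p = wirtinger zi wi d (wirtinger zi wi c f) p"
proof -
  define D where "D u = (\<lambda>p. frechet_derivative f (at p) u)" for u
  have D: "D u differentiable (at x)" if "x \<in> S" for u x
    unfolding D_def using assms(2) that
    by (metis numeral_2_eq_2 times_differentiable_SucD)
  have f: "(f has_derivative frechet_derivative f (at x)) (at x)" if "x \<in> S" for x
    using assms(2) that times_differentiable_SucD(1)
    by (metis numeral_2_eq_2 frechet_derivative_works)
  have sym: "frechet_derivative (D u) (at p) v = frechet_derivative (D v) (at p) u" for u v
    using symmetric_second_derivative[OF assms(1,3) f, of u _ v] D[OF assms(3)]
    unfolding D_def frechet_derivative_works by blast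
  have expand: "frechet_derivative (wirtinger zi wi c f) (at p) v =
      (frechet_derivative (D (re_direction zi wi c)) (at p) v
       + im_coeff c * frechet_derivative (D (im_direction zi wi c)) (at p) v) / 2" for c v
  proof -
    have eq: "wirtinger zi wi c f = (\<lambda>x. (D (re_direction zi wi c) x + im_coeff c * D (im_direction zi wi c) x) / 2)"
      by (simp add: fun_eq_iff wirtinger_eq D_def)
    have "(wirtinger zi wi c f has_derivative (\<lambda>v. (frechet_derivative (D (re_direction zi wi c)) (at p) v
       + im_coeff c * frechet_derivative (D (im_direction zi wi c)) (at p) v) / 2)) (at p)"
      unfolding eq
      by (auto intro!: derivative_eq_intros D[OF assms(3), unfolded frechet_derivative_works])
    from fun_cong[OF frechet_derivative_at[OF this]] show ?thesis by simp
  qed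
  show ?thesis
    unfolding wirtinger_eq[of zi wi c "wirtinger zi wi d f"] wirtinger_eq[of zi wi d "wirtinger zi wi c f"] expand
    unfolding sym[of "re_direction zi wi d" "re_direction zi wi c"] sym[of "re_direction zi wi d" "im_direction zi wi c"]
      sym[of "im_direction zi wi d" "re_direction zi wi c"] sym[of "im_direction zi wi d" "im_direction zi wi c"]
    by (simp add: field_simps)
qed

text \<open>
  Functions annihilated by \<open>\<partial>\<^sub>c\<close> pass through every power of \<open>\<partial>\<^sub>c\<close> like constants, since all terms of
  the Leibniz rule but one vanish.
\<close>

lemma wirtinger_power_combination:
  assumes "open S" "finite I"
    and \<phi>: "\<And>i x. i \<in> I \<Longrightarrow> x \<in> S \<Longrightarrow> \<phi> i differentiable (at x)"
      "\<And>i x. i \<in> I \<Longrightarrow> x \<in> S \<Longrightarrow> wirtinger zi wi c (\<phi> i) x = 0"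
    and F: "\<And>i. i \<in> I \<Longrightarrow> times_differentiable q S (F i)"
    and p: "p \<in> S"
  shows "(wirtinger zi wi c ^^ q) (\<lambda>x. \<Sum>i\<in>I. \<phi> i x * F i x) p
    = (\<Sum>i\<in>I. \<phi> i p * (wirtinger zi wi c ^^ q) (F i) p)"
  using F p
proof (induction q arbitrary: p)
  case (Suc q)
  let ?D = "wirtinger zi wi c ^^ q"
  have FD: "?D (F i) differentiable (at p)" if "i \<in> I" for i
    using times_differentiable_wirtinger_power[OF assms(1), of q "Suc 0" "F i"] Suc.prems that by auto
  have "(wirtinger zi wi c ^^ Suc q) (\<lambda>x. \<Sum>i\<in>I. \<phi> i x * F i x) p
      = wirtinger zi wi c (\<lambda>x. \<Sum>i\<in>I. \<phi> i x * ?D (F i) x) p"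
    unfolding funpow.simps o_apply
    using Suc.prems(1)[THEN times_differentiable_Suc_imp]
    by (intro wirtinger_cong[OF assms(1) Suc.prems(2)] Suc.IH)
  also have "\<dots> = (\<Sum>i\<in>I. wirtinger zi wi c (\<lambda>x. \<phi> i x * ?D (F i) x) p)"
    using FD \<phi> Suc.prems by (intro wirtinger_sum differentiable_mult) auto
  also have "\<dots> = (\<Sum>i\<in>I. \<phi> i p * wirtinger zi wi c (?D (F i)) p)"
    using FD \<phi> Suc.prems by (intro sum.cong refl) (simp add: wirtinger_mult)
  finally show ?case by simp
qed simp


section \<open>Functions holomorphic or antiholomorphic in given variables\<close>

lemma of_form_imp_differentiable:
  "of_form zi wi r V S f \<Longrightarrow> 1 \<le> r \<Longrightarrow> p \<in> S \<Longrightarrow> f differentiable (at p)"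
  unfolding of_form_def using R_differentiable_imp_differentiable by blast

lemma of_form_const: "of_form zi wi r V S (\<lambda>_. a)"
  by (simp add: of_form_def R_differentiable_def times_differentiable_const)

text \<open>
  The null variables of \<open>f\<close> remain null for its Wirtinger derivatives, because these commute. One order
  of differentiability is lost.
\<close>

lemma of_form_wirtinger:
  assumes S: "open S" and r: "1 \<le> r" and f: "of_form zi wi (r + 1) V S f"
  shows "of_form zi wi r V S (wirtinger zi wi d f)"
  unfolding of_form_def
proof (intro conjI ballI)
  show "R_differentiable r S (wirtinger zi wi d f)"
    using R_differentiable_wirtinger[OF S] f by (simp add: of_form_def)
  fix c p assume c: "c \<in> V" and p: "p \<in> S"
  have "times_differentiable 2 S f"
    using R_differentiable_SucD[of r S f 1] f r by (simp add: of_form_def one_enat_def numeral_2_eq_2)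
  then have "wirtinger zi wi c (wirtinger zi wi d f) p = wirtinger zi wi d (wirtinger zi wi c f) p"
    by (rule wirtinger_commute[OF S _ p])
  also have "\<dots> = wirtinger zi wi d (\<lambda>_. 0) p"
    using f c by (intro wirtinger_cong[OF S p]) (simp add: of_form_def)
  finally show "wirtinger zi wi c (wirtinger zi wi d f) p = 0" by simp
qed

text \<open>
  How the derived equations of (E) follow from an underived one: the first application of \<open>\<partial>\<^sub>c\<close>
  removes \<open>g\<close>, and every application passes through the \<open>\<phi> i\<close>.
\<close>

lemma wirtinger_power_equation:
  assumes S: "open S" and "finite I" and r: "1 \<le> r" and "c \<in> V" "0 < q"
    and g: "of_form zi wi r V S g" and \<phi>: "\<And>i. i \<in> I \<Longrightarrow> of_form zi wi r V S (\<phi> i)"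
    and F: "\<And>i. i \<in> I \<Longrightarrow> times_differentiable q S (F i)"
    and h: "\<And>x. x \<in> S \<Longrightarrow> g x + (\<Sum>i\<in>I. \<phi> i x * F i x) = h x"
    and p: "p \<in> S"
  shows "(\<Sum>i\<in>I. \<phi> i p * (wirtinger zi wi c ^^ q) (F i) p) = (wirtinger zi wi c ^^ q) h p"
proof -
  obtain q' where q': "q = Suc q'" using \<open>0 < q\<close> gr0_implies_Suc by blast
  let ?A = "\<lambda>x. \<Sum>i\<in>I. \<phi> i x * F i x"
  have diff: "g differentiable (at x)" "\<And>i. i \<in> I \<Longrightarrow> \<phi> i differentiable (at x)"
      "\<And>i. i \<in> I \<Longrightarrow> F i differentiable (at x)" if "x \<in> S" for x
    using of_form_imp_differentiable[OF g r that] of_form_imp_differentiable[OF \<phi> r that]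
      times_differentiable_SucD(1)[OF F[unfolded q'] that] by auto
  have first: "wirtinger zi wi c h x = wirtinger zi wi c ?A x" if x: "x \<in> S" for x
  proof -
    have "wirtinger zi wi c h x = wirtinger zi wi c (\<lambda>x. g x + ?A x) x"
      using h by (intro wirtinger_cong[OF S x]) simp
    also have "\<dots> = wirtinger zi wi c g x + wirtinger zi wi c ?A x"
      using diff[OF x] \<open>finite I\<close> by (intro wirtinger_add differentiable_sum differentiable_mult) auto
    also have "wirtinger zi wi c g x = 0"
      using g x \<open>c \<in> V\<close> by (simp add: of_form_def)
    finally show ?thesis by simp
  qed
  have "(wirtinger zi wi c ^^ q) h p = (wirtinger zi wi c ^^ q') (wirtinger zi wi c h) p"
    by (simp add: q' funpow_swap1)
  also have "\<dots> = (wirtinger zi wi c ^^ q') (wirtinger zi wi c ?A) p"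
    using wirtinger_power_cong[OF S first p] .
  also have "\<dots> = (wirtinger zi wi c ^^ q) ?A p"
    by (simp add: q' funpow_swap1)
  also have "\<dots> = (\<Sum>i\<in>I. \<phi> i p * (wirtinger zi wi c ^^ q) (F i) p)"
    using diff F \<phi> \<open>c \<in> V\<close> by (intro wirtinger_power_combination[OF S \<open>finite I\<close>] p) (auto simp: of_form_def)
  finally show ?thesis by simp
qed

section \<open>The differential in complex coordinates\<close>

text \<open>
  A real-linear map on a complex line is \<open>a \<mapsto> \<alpha> a + \<beta> (cnj a)\<close>. The map \<open>e\<close> parametrizes the line
  by \<open>\<complex>\<close>; it stands for the embeddings of the \<open>z\<close> and of the \<open>w\<close> coordinate lines.
\<close>

lemma complex_linear_expansion:
  fixes L :: "'a::real_vector \<Rightarrow> complex"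
  assumes L: "linear L" and e: "e a = Re a *\<^sub>R e 1 + Im a *\<^sub>R e \<i>"
  shows "L (e a) = (L (e 1) - \<i> * L (e \<i>)) / 2 * a + (L (e 1) + \<i> * L (e \<i>)) / 2 * cnj a"
proof -
  have "a = Re a + \<i> * Im a" "cnj a = Re a - \<i> * Im a"
    by (simp_all add: complex_eq_iff)
  then obtain x y :: real where xy: "Re a = x" "Im a = y" "a = x + \<i> * y" "cnj a = x - \<i> * y" by blast
  have "L (e a) = x * L (e 1) + y * L (e \<i>)"
    by (subst e) (simp add: linear_add[OF L] linear_scale[OF L] xy(1,2) scaleR_conv_of_real)
  then show ?thesis
    unfolding xy(4) by (subst (2) xy(3)) (simp add: field_simps)
qed

text \<open>The formula \<open>df = \<Sum> \<partial>\<^sub>c f dc\<close> over all coordinates and their conjugates.\<close>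

lemma frechet_derivative_wirtinger_expansion:
  fixes f :: "('m::finite, 'n::finite) point \<Rightarrow> complex"
  assumes zi: "bij_betw zi {1..m} UNIV" and wi: "bij_betw wi {1..n} UNIV"
    and f: "f differentiable (at p)"
  shows "frechet_derivative f (at p) v =
    (\<Sum>j=1..m. wirtinger zi wi (Z j) f p * dcoord zi wi (Z j) v)
    + (\<Sum>j=1..m. wirtinger zi wi (Zbar j) f p * dcoord zi wi (Zbar j) v)
    + (\<Sum>i=1..n. wirtinger zi wi (W i) f p * dcoord zi wi (W i) v)
    + (\<Sum>i=1..n. wirtinger zi wi (Wbar i) f p * dcoord zi wi (Wbar i) v)"
proof -
  define L where "L = frechet_derivative f (at p)"
  have L: "linear L"
    using f unfolding L_def frechet_derivative_works by (rule has_derivative_linear)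
  have axis: "axis k a = Re a *\<^sub>R axis k 1 + Im a *\<^sub>R axis k \<i>" for k :: "'k::finite" and a
    by (auto simp: vec_eq_iff axis_def complex_eq_iff)
  have L_z: "L (axis k a, 0) = (L (axis k 1, 0) - \<i> * L (axis k \<i>, 0)) / 2 * a
      + (L (axis k 1, 0) + \<i> * L (axis k \<i>, 0)) / 2 * cnj a" for k a
    by (rule complex_linear_expansion[OF L, where e = "\<lambda>a. (axis k a, 0)"]) (use axis[of k a] in simp)
  have L_w: "L (0, axis k a) = (L (0, axis k 1) - \<i> * L (0, axis k \<i>)) / 2 * a
      + (L (0, axis k 1) + \<i> * L (0, axis k \<i>)) / 2 * cnj a" for k a
    by (rule complex_linear_expansion[OF L, where e = "\<lambda>a. (0, axis k a)"]) (use axis[of k a] in simp)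
  have v: "v = (\<Sum>k\<in>UNIV. (axis k (fst v $ k), 0)) + (\<Sum>k\<in>UNIV. (0, axis k (snd v $ k)))"
    by (simp add: prod_eq_iff fst_sum snd_sum vec_eq_iff axis_def)
  have "L v = (\<Sum>k\<in>UNIV. L (axis k (fst v $ k), 0)) + (\<Sum>k\<in>UNIV. L (0, axis k (snd v $ k)))"
    by (subst v) (simp add: linear_add[OF L] linear_sum[OF L])
  also have "(\<Sum>k\<in>UNIV. L (axis k (fst v $ k), 0)) = (\<Sum>j=1..m. L (axis (zi j) (fst v $ zi j), 0))"
    by (rule sum.reindex_bij_betw[OF zi, symmetric])
  also have "\<dots> = (\<Sum>j=1..m. wirtinger zi wi (Z j) f p * dcoord zi wi (Z j) v
      + wirtinger zi wi (Zbar j) f p * dcoord zi wi (Zbar j) v)"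
    unfolding wirtinger.simps dcoord.simps L_def[symmetric] by (intro sum.cong refl) (rule L_z)
  also have "(\<Sum>k\<in>UNIV. L (0, axis k (snd v $ k))) = (\<Sum>i=1..n. L (0, axis (wi i) (snd v $ wi i)))"
    by (rule sum.reindex_bij_betw[OF wi, symmetric])
  also have "\<dots> = (\<Sum>i=1..n. wirtinger zi wi (W i) f p * dcoord zi wi (W i) v
      + wirtinger zi wi (Wbar i) f p * dcoord zi wi (Wbar i) v)"
    unfolding wirtinger.simps dcoord.simps L_def[symmetric] by (intro sum.cong refl) (rule L_w)
  finally show ?thesis by (simp add: L_def sum.distrib add.assoc)
qed

lemma sum_permuted_initial_segment:
  fixes F :: "nat \<Rightarrow> 'a::comm_monoid_add"
  assumes "\<zeta> permutes {1..n}" "k \<le> n" "\<And>i. k < i \<Longrightarrow> i \<le> n \<Longrightarrow> F (\<zeta> i) = 0"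
  shows "(\<Sum>i=1..n. F i) = (\<Sum>i=1..k. F (\<zeta> i))"
proof -
  have "(\<Sum>i=1..n. F i) = (\<Sum>i=1..n. F (\<zeta> i))"
    using sum.permute[OF assms(1), of F] by simp
  also have "\<dots> = (\<Sum>i=1..k. F (\<zeta> i))"
    using assms by (intro sum.mono_neutral_right) auto
  finally show ?thesis .
qed

lemmas sum_initial_segment = sum_permuted_initial_segment[OF permutes_id, unfolded id_apply]

abbreviation gradient_w where
  "gradient_w zi wi f \<equiv> (\<lambda>i. wirtinger zi wi (W i) f)"

abbreviation gradient_wbar where
  "gradient_wbar zi wi \<zeta> f \<equiv> (\<lambda>\<tau>. wirtinger zi wi (Wbar (\<zeta> \<tau>)) f)"

text \<open>
  The differential of a function of the given form has no components along the null variables, so it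
  is a Pfaffian form of the shape (P).
\<close>

lemma has_derivative_of_form:
  assumes zi: "bij_betw zi {1..m} UNIV" and wi: "bij_betw wi {1..n} UNIV"
    and f: "of_form zi wi r (null_vars m n s1 s2 k1 k2 j \<zeta>) S f" and p: "p \<in> S"
    and diff: "f differentiable (at p)"
    and s: "s1 \<le> m" "s2 \<le> m" and k: "k1 \<le> n" "k2 \<le> n"
    and j: "j permutes {1..m}" and \<zeta>: "\<zeta> permutes {1..n}"
  shows "(f has_derivative pfaff_form zi wi s1 s2 k1 k2 j \<zeta>
    (\<lambda>\<theta>. wirtinger zi wi (Z \<theta>) f) (\<lambda>g. wirtinger zi wi (Zbar (j g)) f)
    (gradient_w zi wi f) (gradient_wbar zi wi \<zeta> f) p) (at p)" (is "(f has_derivative ?\<omega>) (at p)")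
proof -
  have null: "wirtinger zi wi c f p = 0" if "c \<in> null_vars m n s1 s2 k1 k2 j \<zeta>" for c
    using f p that by (simp add: of_form_def)
  have "(\<Sum>i=1..m. wirtinger zi wi (Z i) f p * dcoord zi wi (Z i) v)
      = (\<Sum>i=1..s1. wirtinger zi wi (Z i) f p * dcoord zi wi (Z i) v)" for v
    using s null by (intro sum_initial_segment) (auto simp: null_vars_def)
  moreover have "(\<Sum>i=1..m. wirtinger zi wi (Zbar i) f p * dcoord zi wi (Zbar i) v)
      = (\<Sum>i=1..s2. wirtinger zi wi (Zbar (j i)) f p * dcoord zi wi (Zbar (j i)) v)" for v
    using s j null by (intro sum_permuted_initial_segment) (auto simp: null_vars_def)
  moreover have "(\<Sum>i=1..n. wirtinger zi wi (W i) f p * dcoord zi wi (W i) v)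
      = (\<Sum>i=1..k1. wirtinger zi wi (W i) f p * dcoord zi wi (W i) v)" for v
    using k null by (intro sum_initial_segment) (auto simp: null_vars_def)
  moreover have "(\<Sum>i=1..n. wirtinger zi wi (Wbar i) f p * dcoord zi wi (Wbar i) v)
      = (\<Sum>i=1..k2. wirtinger zi wi (Wbar (\<zeta> i)) f p * dcoord zi wi (Wbar (\<zeta> i)) v)" for v
    using k \<zeta> null by (intro sum_permuted_initial_segment) (auto simp: null_vars_def)
  ultimately have "frechet_derivative f (at p) v = ?\<omega> v" for v
    unfolding frechet_derivative_wirtinger_expansion[OF zi wi diff] pfaff_form_def by simp
  then have "frechet_derivative f (at p) = ?\<omega>" by blast
  then show ?thesis
    using diff unfolding frechet_derivative_works by simp
qed

text \<open>
  Comparing coefficients in \<open>\<mu> \<omega> = df\<close> requires that the Wirtinger derivatives be dual to the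
  differentials of the coordinates and their conjugates. The indices are restricted to the range
  where the numberings are injective.
\<close>

definition coordinates :: "nat \<Rightarrow> nat \<Rightarrow> cvar set" where
  "coordinates m n = Z ` {1..m} \<union> Zbar ` {1..m} \<union> W ` {1..n} \<union> Wbar ` {1..n}"

lemma wirtinger_dcoord_dual:
  assumes zi: "inj_on zi {1..m}" and wi: "inj_on wi {1..n}"
    and c: "c \<in> coordinates m n" and d: "d \<in> coordinates m n"
  shows "(dcoord zi wi c (re_direction zi wi d) + im_coeff d * dcoord zi wi c (im_direction zi wi d)) / 2
    = of_bool (c = d)"
  using c d inj_on_eq_iff[OF zi] inj_on_eq_iff[OF wi]
  by (cases c; cases d) (auto simp: coordinates_def axis_def)

text \<open>
  Each of the four sums contributes the coefficient of \<open>d\<close>, if it has one. Keeping the indicator of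
  \<open>c = d\<close> under the sums covers all kinds of \<open>d\<close> at once.
\<close>

lemma wirtinger_pfaff_form:
  assumes zi: "inj_on zi {1..m}" and wi: "inj_on wi {1..n}"
    and s: "s1 \<le> m" "s2 \<le> m" and k: "k1 \<le> n" "k2 \<le> n"
    and j: "j permutes {1..m}" and \<zeta>: "\<zeta> permutes {1..n}"
    and df: "(f has_derivative (\<lambda>v. a * pfaff_form zi wi s1 s2 k1 k2 j \<zeta> \<psi>1 \<psi>2 \<phi>1 \<phi>2 p v)) (at p)"
    and d: "d \<in> coordinates m n"
  shows "wirtinger zi wi d f p = a *
    ((\<Sum>\<theta>=1..s1. \<psi>1 \<theta> p * of_bool (Z \<theta> = d)) + (\<Sum>g=1..s2. \<psi>2 g p * of_bool (Zbar (j g) = d))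
     + (\<Sum>\<xi>=1..k1. \<phi>1 \<xi> p * of_bool (W \<xi> = d)) + (\<Sum>\<tau>=1..k2. \<phi>2 \<tau> p * of_bool (Wbar (\<zeta> \<tau>) = d)))"
proof -
  have jm: "j g \<in> {1..m}" if "g \<in> {1..s2}" for g
    using that s permutes_in_image[OF j, of g] by auto
  have \<zeta>n: "\<zeta> \<tau> \<in> {1..n}" if "\<tau> \<in> {1..k2}" for \<tau>
    using that k permutes_in_image[OF \<zeta>, of \<tau>] by auto
  have pair: "(\<Sum>i\<in>I. b i * dcoord zi wi (c i) (re_direction zi wi d))
      + im_coeff d * (\<Sum>i\<in>I. b i * dcoord zi wi (c i) (im_direction zi wi d))
      = 2 * (\<Sum>i\<in>I. b i * of_bool (c i = d))"
    if c: "\<And>i. i \<in> I \<Longrightarrow> c i \<in> coordinates m n" for I and b :: "nat \<Rightarrow> complex" and c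
  proof -
    have "b i * dcoord zi wi (c i) (re_direction zi wi d)
        + im_coeff d * (b i * dcoord zi wi (c i) (im_direction zi wi d)) = 2 * (b i * of_bool (c i = d))"
      if "i \<in> I" for i
      unfolding wirtinger_dcoord_dual[OF zi wi c[OF that] d, symmetric] by (simp add: algebra_simps)
    then show ?thesis
      unfolding sum_distrib_left sum.distrib[symmetric] by (intro sum.cong) auto
  qed
  let ?\<omega> = "pfaff_form zi wi s1 s2 k1 k2 j \<zeta> \<psi>1 \<psi>2 \<phi>1 \<phi>2 p"
  have "wirtinger zi wi d f p = a * (?\<omega> (re_direction zi wi d) + im_coeff d * ?\<omega> (im_direction zi wi d)) / 2"
    unfolding wirtinger_eq frechet_derivative_at[OF df, symmetric] by (simp add: algebra_simps)
  also have "?\<omega> (re_direction zi wi d) + im_coeff d * ?\<omega> (im_direction zi wi d) =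
    2 * ((\<Sum>\<theta>=1..s1. \<psi>1 \<theta> p * of_bool (Z \<theta> = d)) + (\<Sum>g=1..s2. \<psi>2 g p * of_bool (Zbar (j g) = d))
     + (\<Sum>\<xi>=1..k1. \<phi>1 \<xi> p * of_bool (W \<xi> = d)) + (\<Sum>\<tau>=1..k2. \<phi>2 \<tau> p * of_bool (Wbar (\<zeta> \<tau>) = d)))"
  proof -
    have "Z \<theta> \<in> coordinates m n" if "\<theta> \<in> {1..s1}" for \<theta>
      using that s by (simp add: coordinates_def)
    note e1 = pair[where I = "{1..s1}" and c = "Z" and b = "\<lambda>\<theta>. \<psi>1 \<theta> p", OF this]
    have "Zbar (j g) \<in> coordinates m n" if "g \<in> {1..s2}" for g
      using jm[OF that] by (simp add: coordinates_def)
    note e2 = pair[where I = "{1..s2}" and c = "\<lambda>g. Zbar (j g)" and b = "\<lambda>g. \<psi>2 g p", OF this]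
    have "W \<xi> \<in> coordinates m n" if "\<xi> \<in> {1..k1}" for \<xi>
      using that k by (simp add: coordinates_def)
    note e3 = pair[where I = "{1..k1}" and c = "W" and b = "\<lambda>\<xi>. \<phi>1 \<xi> p", OF this]
    have "Wbar (\<zeta> \<tau>) \<in> coordinates m n" if "\<tau> \<in> {1..k2}" for \<tau>
      using \<zeta>n[OF that] by (simp add: coordinates_def)
    note e4 = pair[where I = "{1..k2}" and c = "\<lambda>\<tau>. Wbar (\<zeta> \<tau>)" and b = "\<lambda>\<tau>. \<phi>2 \<tau> p", OF this]
    have "x1 + x2 + x3 + x4 + c * (y1 + y2 + y3 + y4) = 2 * (z1 + z2 + z3 + z4)"
      if "x1 + c * y1 = 2 * z1" "x2 + c * y2 = 2 * z2" "x3 + c * y3 = 2 * z3" "x4 + c * y4 = 2 * z4"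
      for c x1 x2 x3 x4 y1 y2 y3 y4 z1 z2 z3 z4 :: complex
      using that by algebra
    from this[OF e1 e2 e3 e4] show ?thesis
      unfolding pfaff_form_def .
  qed
  finally show ?thesis by (simp only: mult.left_commute[of a 2]) simp
qed

lemma wirtinger_of_integral:
  assumes zi: "inj_on zi {1..m}" and wi: "inj_on wi {1..n}"
    and s: "s1 \<le> m" "s2 \<le> m" and k: "k1 \<le> n" "k2 \<le> n"
    and j: "j permutes {1..m}" and \<zeta>: "\<zeta> permutes {1..n}"
    and df: "(f has_derivative (\<lambda>v. a * pfaff_form zi wi s1 s2 k1 k2 j \<zeta> \<psi>1 \<psi>2 \<phi>1 \<phi>2 p v)) (at p)"
  shows "\<theta> \<in> {1..s1} \<Longrightarrow> wirtinger zi wi (Z \<theta>) f p = a * \<psi>1 \<theta> p"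
    and "g \<in> {1..s2} \<Longrightarrow> wirtinger zi wi (Zbar (j g)) f p = a * \<psi>2 g p"
    and "\<xi> \<in> {1..k1} \<Longrightarrow> wirtinger zi wi (W \<xi>) f p = a * \<phi>1 \<xi> p"
    and "\<tau> \<in> {1..k2} \<Longrightarrow> wirtinger zi wi (Wbar (\<zeta> \<tau>)) f p = a * \<phi>2 \<tau> p"
proof -
  note * = wirtinger_pfaff_form[OF zi wi s k j \<zeta> df]
  have inj: "j x = j y \<longleftrightarrow> x = y" "\<zeta> x = \<zeta> y \<longleftrightarrow> x = y" for x y
    using permutes_inj[OF j] permutes_inj[OF \<zeta>] by (auto dest: injD)
  show "wirtinger zi wi (Z \<theta>) f p = a * \<psi>1 \<theta> p" if "\<theta> \<in> {1..s1}"
    using that s *[of "Z \<theta>"] by (simp add: coordinates_def)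
  show "wirtinger zi wi (Zbar (j g)) f p = a * \<psi>2 g p" if "g \<in> {1..s2}"
    using that s permutes_in_image[OF j, of g] *[of "Zbar (j g)"] by (simp add: coordinates_def inj)
  show "wirtinger zi wi (W \<xi>) f p = a * \<phi>1 \<xi> p" if "\<xi> \<in> {1..k1}"
    using that k *[of "W \<xi>"] by (simp add: coordinates_def)
  show "wirtinger zi wi (Wbar (\<zeta> \<tau>)) f p = a * \<phi>2 \<tau> p" if "\<tau> \<in> {1..k2}"
    using that k permutes_in_image[OF \<zeta>, of \<tau>] *[of "Wbar (\<zeta> \<tau>)"] by (simp add: coordinates_def inj)
qed


section \<open>The operators of the system on functions of the given form\<close>

lemma phi_X_split:
  "phi_X m k1 k2 \<zeta> X \<phi>1 \<phi>2 l p = (\<Sum>\<xi>=1..k1. \<phi>1 \<xi> p * X \<xi> l p)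
    + (\<Sum>\<tau>=1..k2. \<phi>2 \<tau> p * cnj (X (\<zeta> \<tau>) (conj_index m l) p))"
proof -
  have "(\<Sum>i=1..k1+k2. lam_phi k1 \<phi>1 \<phi>2 i p * lam_X m k1 \<zeta> X l i p)
    = (\<Sum>i=1..k1. lam_phi k1 \<phi>1 \<phi>2 i p * lam_X m k1 \<zeta> X l i p)
      + (\<Sum>i=k1+1..k1+k2. lam_phi k1 \<phi>1 \<phi>2 i p * lam_X m k1 \<zeta> X l i p)"
    by (rule sum.ub_add_nat) simp
  also have "(\<Sum>i=k1+1..k1+k2. lam_phi k1 \<phi>1 \<phi>2 i p * lam_X m k1 \<zeta> X l i p)
    = (\<Sum>\<tau>=1..k2. lam_phi k1 \<phi>1 \<phi>2 (\<tau> + k1) p * lam_X m k1 \<zeta> X l (\<tau> + k1) p)"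
    using sum.shift_bounds_cl_nat_ivl[of _ 1 k1 k2] by (simp add: add.commute)
  finally show ?thesis
    unfolding phi_X_def by (simp add: lam_phi_def lam_X_def)
qed

text \<open>The variable whose derivative is the leading term of \<open>\<XX>\<^sub>l\<close>.\<close>

definition base_var :: "nat \<Rightarrow> nat \<Rightarrow> cvar" where
  "base_var m l = (if l \<le> m then Z l else Zbar (l - m))"

text \<open>
  The derivatives along the null variables \<open>w\<^sub>\<gamma>\<close>, \<open>\<gamma> > k1\<close>, and along the conjugates of
  \<open>w\<^bsub>\<zeta> \<delta>\<^esub>\<close>, \<open>\<delta> > k2\<close>, drop out of \<open>\<XX>\<^sub>l f\<close>.
\<close>

lemma op_X_of_form:
  assumes f: "of_form zi wi r (null_vars m n s1 s2 k1 k2 j \<zeta>) S f" and p: "p \<in> S"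
    and k: "k1 \<le> n" "k2 \<le> n" and \<zeta>: "\<zeta> permutes {1..n}"
  shows "op_X m n zi wi X l f p = wirtinger zi wi (base_var m l) f p
    + phi_X m k1 k2 \<zeta> X (gradient_w zi wi f) (gradient_wbar zi wi \<zeta> f) l p"
proof -
  have W: "wirtinger zi wi (W i) f p = 0" if "k1 < i" "i \<le> n" for i
    using f p that by (auto simp: of_form_def null_vars_def)
  have Wbar: "wirtinger zi wi (Wbar (\<zeta> i)) f p = 0" if "k2 < i" "i \<le> n" for i
    using f p that by (auto simp: of_form_def null_vars_def)
  have "(\<Sum>\<xi>=1..n. X \<xi> l p * wirtinger zi wi (W \<xi>) f p)
      = (\<Sum>\<xi>=1..k1. X \<xi> l p * wirtinger zi wi (W \<xi>) f p)"
    using W k by (intro sum_initial_segment) auto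
  moreover have "(\<Sum>\<xi>=1..n. cnj (X \<xi> (conj_index m l) p) * wirtinger zi wi (Wbar \<xi>) f p)
      = (\<Sum>\<tau>=1..k2. cnj (X (\<zeta> \<tau>) (conj_index m l) p) * wirtinger zi wi (Wbar (\<zeta> \<tau>)) f p)"
    using Wbar k \<zeta> by (intro sum_permuted_initial_segment) auto
  ultimately show ?thesis
    unfolding op_X_def phi_X_split base_var_def by (simp add: sum.distrib mult.commute)
qed

section \<open>Partial integrals and system (E)\<close>

lemma conj_index_range: "l \<in> {1..2*m} \<Longrightarrow> conj_index m l \<in> {1..2*m}"
  by (auto simp: conj_index_def)

lemma of_form_lam_phi:
  assumes "\<And>\<xi>. \<xi> \<in> {1..k1} \<Longrightarrow> of_form zi wi r V S (\<phi>1 \<xi>)"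
    and "\<And>\<tau>. \<tau> \<in> {1..k2} \<Longrightarrow> of_form zi wi r V S (\<phi>2 \<tau>)"
    and "i \<in> {1..k1+k2}"
  shows "of_form zi wi r V S (lam_phi k1 \<phi>1 \<phi>2 i)"
  using assms(1)[of i] assms(2)[of "i - k1"] assms(3)
  by (auto simp: lam_phi_def[abs_def] Suc_le_eq)

lemma R_differentiable_lam_X:
  assumes S: "open S" and X: "\<And>\<xi> l. \<xi> \<in> {1..n} \<Longrightarrow> l \<in> {1..2*m} \<Longrightarrow> R_differentiable r S (X \<xi> l)"
    and k: "k1 \<le> n" "k2 \<le> n" and \<zeta>: "\<zeta> permutes {1..n}"
    and i: "i \<in> {1..k1+k2}" and l: "l \<in> {1..2*m}"
  shows "R_differentiable r S (lam_X m k1 \<zeta> X l i)"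
proof (cases "i \<le> k1")
  case True
  then show ?thesis using X[of i l] i k l by (simp add: lam_X_def)
next
  case False
  then have "\<zeta> (i - k1) \<in> {1..n}"
    using permutes_in_image[OF \<zeta>, of "i - k1"] i k by auto
  then show ?thesis
    using R_differentiable_cnj[OF S X[OF _ conj_index_range[OF l]]] False by (simp add: lam_X_def)
qed

lemma R_differentiable_op_X:
  assumes S: "open S" and f: "R_differentiable (r + 1) S f"
    and X: "\<And>\<xi> l. \<xi> \<in> {1..n} \<Longrightarrow> l \<in> {1..2*m} \<Longrightarrow> R_differentiable r S (X \<xi> l)" and l: "l \<in> {1..2*m}"
  shows "R_differentiable r S (op_X m n zi wi X l f)"
proof -
  have "R_differentiable r S (\<lambda>p. wirtinger zi wi (if l \<le> m then Z l else Zbar (l - m)) f p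
     + (\<Sum>\<xi>=1..n. X \<xi> l p * wirtinger zi wi (W \<xi>) f p
                  + cnj (X \<xi> (conj_index m l) p) * wirtinger zi wi (Wbar \<xi>) f p))"
    using X l conj_index_range[OF l]
    by (intro R_differentiable_add[OF S] R_differentiable_sum[OF S] R_differentiable_mult[OF S]
        R_differentiable_cnj[OF S] R_differentiable_wirtinger[OF S f]) auto
  then show ?thesis by (simp add: op_X_def[abs_def])
qed

text \<open>
  All blocks of (E) are instances of one family of equations over \<open>l\<close>: for \<open>l\<close> in the blocks
  without \<open>\<psi>\<close>, the base derivative of \<open>f\<close> is zero.
\<close>

lemma partial_integral_solves_system_E:
  fixes X :: "nat \<Rightarrow> nat \<Rightarrow> ('m::finite, 'n::finite) point \<Rightarrow> complex"
  assumes S: "open S" and r: "enat (max 1 (k1 + k2)) \<le> r"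
    and V: "V = null_vars m n s1 s2 k1 k2 j \<zeta>"
    and s: "s1 \<le> m" "s2 \<le> m" and k: "k1 \<le> n" "k2 \<le> n"
    and j: "j permutes {1..m}" and \<zeta>: "\<zeta> permutes {1..n}"
    and X: "\<And>\<xi> l. \<xi> \<in> {1..n} \<Longrightarrow> l \<in> {1..2*m} \<Longrightarrow> R_differentiable r S (X \<xi> l)"
    and f: "of_form zi wi (r + 1) V S f"
    and H: "\<And>l p. l \<in> {1..2*m} \<Longrightarrow> p \<in> S \<Longrightarrow> op_X m n zi wi X l f p = H l (f p) p"
  shows "system_E m zi wi X S s1 s2 k1 k2 j \<zeta> V
    (\<lambda>\<theta>. wirtinger zi wi (Z \<theta>) f) (\<lambda>g. wirtinger zi wi (Zbar (j g)) f)
    (gradient_w zi wi f) (gradient_wbar zi wi \<zeta> f) H f"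
proof -
  have "enat 1 \<le> enat (max 1 (k1 + k2))" "enat (k1 + k2) \<le> enat (max 1 (k1 + k2))" by simp_all
  with r have r1: "1 \<le> r" and r_lam: "enat (k1 + k2) \<le> r"
    by (metis one_enat_def order_trans)+
  let ?\<phi>1 = "gradient_w zi wi f" and ?\<phi>2 = "gradient_wbar zi wi \<zeta> f"
  note grad = of_form_wirtinger[OF S r1 f]
  have E: "wirtinger zi wi (base_var m l) f p + phi_X m k1 k2 \<zeta> X ?\<phi>1 ?\<phi>2 l p = H l (f p) p"
    if "l \<in> {1..2*m}" "p \<in> S" for l p
    using op_X_of_form[OF f[unfolded V] that(2) k \<zeta>, of X l] H[OF that] by simp
  have dE: "phi_dX m zi wi k1 k2 \<zeta> X ?\<phi>1 ?\<phi>2 c q l p = (wirtinger zi wi c ^^ q) (\<lambda>p. H l (f p) p) p"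
    if l: "l \<in> {1..2*m}" and p: "p \<in> S" and c: "c \<in> V" and q: "q \<in> {1..k1+k2}" for l p c q
    unfolding phi_dX_def
  proof (rule wirtinger_power_equation[OF S _ r1 c])
    show "of_form zi wi r V S (lam_phi k1 ?\<phi>1 ?\<phi>2 i)" if "i \<in> {1..k1+k2}" for i
      using that by (intro of_form_lam_phi grad)
    show "times_differentiable q S (lam_X m k1 \<zeta> X l i)" if "i \<in> {1..k1+k2}" for i
    proof -
      have "enat q \<le> r" using q r_lam by (auto intro: order_trans[of _ "enat (k1 + k2)"])
      then show ?thesis
        using R_differentiable_lam_X[where X = X, OF S X k \<zeta> that l] by (simp add: R_differentiable_def)
    qed
    show "wirtinger zi wi (base_var m l) f x
        + (\<Sum>i=1..k1+k2. lam_phi k1 ?\<phi>1 ?\<phi>2 i x * lam_X m k1 \<zeta> X l i x) = H l (f x) x" if "x \<in> S" for x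
      using E[OF l that] by (simp add: phi_X_def)
  qed (use grad q p in auto)
  have z: "base_var m l = Z l" if "l \<le> m" for l using that by (simp add: base_var_def)
  have zbar: "base_var m (m + j i) = Zbar (j i)" "m + j i \<in> {1..2*m}" if "i \<in> {1..m}" for i
    using that permutes_in_image[OF j, of i] by (auto simp: base_var_def)
  have zero: "wirtinger zi wi (Z i) f p = 0" if "p \<in> S" "i \<in> {s1+1..m}" for i p
    using f that by (auto simp: of_form_def V null_vars_def)
  have zero': "wirtinger zi wi (Zbar (j i)) f p = 0" if "p \<in> S" "i \<in> {s2+1..m}" for i p
    using f that by (auto simp: of_form_def V null_vars_def)
  show ?thesis
    unfolding system_E_def Let_def
  proof (intro ballI conjI)
    fix p i assume p: "p \<in> S"
    {
      assume i: "i \<in> {1..s1}"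
      then have l: "i \<in> {1..2*m}" and "i \<le> m" using s by auto
      then show "wirtinger zi wi (Z i) f p + phi_X m k1 k2 \<zeta> X ?\<phi>1 ?\<phi>2 i p = H i (f p) p"
        using E[OF l p] z by simp
      show "phi_dX m zi wi k1 k2 \<zeta> X ?\<phi>1 ?\<phi>2 c q i p = (wirtinger zi wi c ^^ q) (\<lambda>p. H i (f p) p) p"
        if "c \<in> V" "q \<in> {1..k1+k2}" for c q
        by (rule dE[OF l p that])
    next
      assume i: "i \<in> {s1+1..m}"
      then have l: "i \<in> {1..2*m}" and "i \<le> m" by auto
      then show "phi_X m k1 k2 \<zeta> X ?\<phi>1 ?\<phi>2 i p = H i (f p) p"
        using E[OF l p] z zero[OF p i] by simp
      show "phi_dX m zi wi k1 k2 \<zeta> X ?\<phi>1 ?\<phi>2 c q i p = (wirtinger zi wi c ^^ q) (\<lambda>p. H i (f p) p) p"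
        if "c \<in> V" "q \<in> {1..k1+k2-1}" for c q
        by (rule dE[OF l p]) (use that in auto)
    next
      assume "i \<in> {1..s2}"
      then have i: "i \<in> {1..m}" using s by auto
      show "wirtinger zi wi (Zbar (j i)) f p + phi_X m k1 k2 \<zeta> X ?\<phi>1 ?\<phi>2 (m + j i) p = H (m + j i) (f p) p"
        using E[OF zbar(2)[OF i] p] zbar(1)[OF i] by simp
      show "phi_dX m zi wi k1 k2 \<zeta> X ?\<phi>1 ?\<phi>2 c q (m + j i) p
          = (wirtinger zi wi c ^^ q) (\<lambda>p. H (m + j i) (f p) p) p"
        if "c \<in> V" "q \<in> {1..k1+k2}" for c q
        by (rule dE[OF zbar(2)[OF i] p that])
    next
      assume i': "i \<in> {s2+1..m}"
      then have i: "i \<in> {1..m}" by auto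
      show "phi_X m k1 k2 \<zeta> X ?\<phi>1 ?\<phi>2 (m + j i) p = H (m + j i) (f p) p"
        using E[OF zbar(2)[OF i] p] zbar(1)[OF i] zero'[OF p i'] by simp
      show "phi_dX m zi wi k1 k2 \<zeta> X ?\<phi>1 ?\<phi>2 c q (m + j i) p
          = (wirtinger zi wi c ^^ q) (\<lambda>p. H (m + j i) (f p) p) p"
        if "c \<in> V" "q \<in> {1..k1+k2-1}" for c q
        by (rule dE[OF zbar(2)[OF i] p]) (use that in auto)
    }
  qed
qed

text \<open>
  The derivatives of \<open>f\<close> are \<open>a\<close> times the coefficients of \<open>\<omega>\<close>, so \<open>\<XX>\<^sub>l f\<close> is \<open>a\<close> times the
  left-hand side of the underived equation of (E) with number \<open>l\<close>. For \<open>l\<close> in a block without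
  \<open>\<psi>\<close> the base derivative of \<open>f\<close> vanishes, since its variable is null.
\<close>

lemma op_X_of_integral:
  fixes X :: "nat \<Rightarrow> nat \<Rightarrow> ('m::finite, 'n::finite) point \<Rightarrow> complex"
  assumes zi: "inj_on zi {1..m}" and wi: "inj_on wi {1..n}"
    and V: "V = null_vars m n s1 s2 k1 k2 j \<zeta>"
    and s: "s1 \<le> m" "s2 \<le> m" and k: "k1 \<le> n" "k2 \<le> n"
    and j: "j permutes {1..m}" and \<zeta>: "\<zeta> permutes {1..n}"
    and E: "system_E m zi wi X S s1 s2 k1 k2 j \<zeta> V \<psi>1 \<psi>2 \<phi>1 \<phi>2 H f"
    and f: "of_form zi wi r V S f" and p: "p \<in> S"
    and df: "(f has_derivative (\<lambda>v. a * pfaff_form zi wi s1 s2 k1 k2 j \<zeta> \<psi>1 \<psi>2 \<phi>1 \<phi>2 p v)) (at p)"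
    and l: "l \<in> {1..2*m}"
  shows "op_X m n zi wi X l f p = a * H l (f p) p"
proof -
  note df_coeffs = wirtinger_of_integral[OF zi wi s k j \<zeta> df]
  have null: "wirtinger zi wi c f p = 0" if "c \<in> V" for c
    using f p that by (simp add: of_form_def)
  have "phi_X m k1 k2 \<zeta> X (gradient_w zi wi f) (gradient_wbar zi wi \<zeta> f) l p
      = a * phi_X m k1 k2 \<zeta> X \<phi>1 \<phi>2 l p"
    unfolding phi_X_split distrib_left sum_distrib_left using df_coeffs(3,4)
    by (intro arg_cong2[where f = "(+)"] sum.cong) auto
  moreover have "wirtinger zi wi (base_var m l) f p + a * phi_X m k1 k2 \<zeta> X \<phi>1 \<phi>2 l p = a * H l (f p) p"
  proof (cases "l \<le> m")
    case True
    then have base: "base_var m l = Z l" by (simp add: base_var_def)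
    show ?thesis
    proof (cases "l \<le> s1")
      case True
      then have "\<psi>1 l p + phi_X m k1 k2 \<zeta> X \<phi>1 \<phi>2 l p = H l (f p) p"
        using E l p by (simp add: system_E_def Let_def)
      then show ?thesis using df_coeffs(1)[of l] True l by (simp add: base distrib_left[symmetric])
    next
      case False
      then have "phi_X m k1 k2 \<zeta> X \<phi>1 \<phi>2 l p = H l (f p) p"
        using E \<open>l \<le> m\<close> p by (simp add: system_E_def Let_def)
      then show ?thesis using null[of "Z l"] False \<open>l \<le> m\<close> by (simp add: base V null_vars_def)
    qed
  next
    case False
    then have "l - m \<in> {1..m}" using l by auto
    then obtain g where g: "g \<in> {1..m}" "j g = l - m"
      using permutes_image[OF j] by (metis imageE)
    then have base: "base_var m l = Zbar (j g)" and lg: "l = m + j g"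
      using False by (simp_all add: base_var_def)
    show ?thesis
    proof (cases "g \<le> s2")
      case True
      then have "\<psi>2 g p + phi_X m k1 k2 \<zeta> X \<phi>1 \<phi>2 l p = H l (f p) p"
        using E g(1) p unfolding lg by (simp add: system_E_def Let_def)
      then show ?thesis using df_coeffs(2)[of g] True g(1) by (simp add: base distrib_left[symmetric])
    next
      case False
      then have "phi_X m k1 k2 \<zeta> X \<phi>1 \<phi>2 l p = H l (f p) p"
        using E g(1) p unfolding lg by (simp add: system_E_def Let_def)
      moreover have "Zbar (j g) \<in> V"
        using False g(1) by (auto simp: V null_vars_def)
      ultimately show ?thesis using null by (simp add: base)
    qed
  qed
  ultimately show ?thesis
    using op_X_of_form[OF f[unfolded V] p k \<zeta>, of X l] by simp
qed

theorem theorem1p4: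
  fixes m n s1 s2 k1 k2 :: nat
    and zi :: "nat \<Rightarrow> 'm::finite" and wi :: "nat \<Rightarrow> 'n::finite"
    and j \<zeta> :: "nat \<Rightarrow> nat"
    and G G' :: "('m, 'n) point set"
    and X :: "nat \<Rightarrow> nat \<Rightarrow> ('m, 'n) point \<Rightarrow> complex"
    and r :: enat
    and V :: "cvar set"
  assumes "bij_betw zi {1..m} UNIV" and "bij_betw wi {1..n} UNIV"
    and "open G" and "connected G" and "G \<noteq> {}"
    and "open G'" and "connected G'" and "G' \<noteq> {}" and "G' \<subseteq> G"
    and "s1 \<le> m" and "s2 \<le> m" and "k1 \<le> n" and "k2 \<le> n"
    and "j permutes {1..m}" and "\<zeta> permutes {1..n}"
    and "enat (max 1 (k1 + k2)) \<le> r"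
    and "\<And>\<xi> l. \<xi> \<in> {1..n} \<Longrightarrow> l \<in> {1..2*m} \<Longrightarrow> R_differentiable r G (X \<xi> l)"
    and "V = null_vars m n s1 s2 k1 k2 j \<zeta>"
  shows
    "((\<exists>f. partial_integral m n zi wi r X G' f \<and> of_form zi wi (r + 1) V G' f) \<longleftrightarrow>
      (\<exists>f \<psi>1 \<psi>2 \<phi>1 \<phi>2 H.
         admissible_unknowns m zi wi r G' s1 s2 k1 k2 V \<psi>1 \<psi>2 \<phi>1 \<phi>2 H f \<and>
         system_E m zi wi X G' s1 s2 k1 k2 j \<zeta> V \<psi>1 \<psi>2 \<phi>1 \<phi>2 H f \<and>
         (\<exists>\<mu>. integrating_factor zi wi r V G'
                (pfaff_form zi wi s1 s2 k1 k2 j \<zeta> \<psi>1 \<psi>2 \<phi>1 \<phi>2) \<mu>) \<and>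
         general_integral zi wi r V G'
           (pfaff_form zi wi s1 s2 k1 k2 j \<zeta> \<psi>1 \<psi>2 \<phi>1 \<phi>2) f))
     \<and>
     (\<forall>f. partial_integral m n zi wi r X G' f \<and> of_form zi wi (r + 1) V G' f \<longleftrightarrow>
      (\<exists>\<psi>1 \<psi>2 \<phi>1 \<phi>2 H.
         admissible_unknowns m zi wi r G' s1 s2 k1 k2 V \<psi>1 \<psi>2 \<phi>1 \<phi>2 H f \<and>
         system_E m zi wi X G' s1 s2 k1 k2 j \<zeta> V \<psi>1 \<psi>2 \<phi>1 \<phi>2 H f \<and>
         (\<exists>\<mu>. integrating_factor zi wi r V G'
                (pfaff_form zi wi s1 s2 k1 k2 j \<zeta> \<psi>1 \<psi>2 \<phi>1 \<phi>2) \<mu>) \<and>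
         general_integral zi wi r V G'
           (pfaff_form zi wi s1 s2 k1 k2 j \<zeta> \<psi>1 \<psi>2 \<phi>1 \<phi>2) f))"
proof -
  note zi = assms(1) and wi = assms(2) and S = \<open>open G'\<close> and sub = \<open>G' \<subseteq> G\<close>
    and s = \<open>s1 \<le> m\<close> \<open>s2 \<le> m\<close> and k = \<open>k1 \<le> n\<close> \<open>k2 \<le> n\<close>
    and j = \<open>j permutes {1..m}\<close> and \<zeta> = \<open>\<zeta> permutes {1..n}\<close>
    and r = assms(16) and XG = assms(17) and V = assms(18)
  have inj: "inj_on zi {1..m}" "inj_on wi {1..n}"
    using zi wi by (auto simp: bij_betw_def)
  have X: "R_differentiable r G' (X \<xi> l)" if "\<xi> \<in> {1..n}" "l \<in> {1..2*m}" for \<xi> l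
    using R_differentiable_subset[OF XG[OF that] sub] .
  have r1: "1 \<le> r"
    using r order_trans[of "enat 1" "enat (max 1 (k1 + k2))" r] by (simp add: one_enat_def)
  have "partial_integral m n zi wi r X G' f \<and> of_form zi wi (r + 1) V G' f \<longleftrightarrow>
      (\<exists>\<psi>1 \<psi>2 \<phi>1 \<phi>2 H.
         admissible_unknowns m zi wi r G' s1 s2 k1 k2 V \<psi>1 \<psi>2 \<phi>1 \<phi>2 H f \<and>
         system_E m zi wi X G' s1 s2 k1 k2 j \<zeta> V \<psi>1 \<psi>2 \<phi>1 \<phi>2 H f \<and>
         (\<exists>\<mu>. integrating_factor zi wi r V G'
                (pfaff_form zi wi s1 s2 k1 k2 j \<zeta> \<psi>1 \<psi>2 \<phi>1 \<phi>2) \<mu>) \<and>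
         general_integral zi wi r V G'
           (pfaff_form zi wi s1 s2 k1 k2 j \<zeta> \<psi>1 \<psi>2 \<phi>1 \<phi>2) f)" (is "?P \<longleftrightarrow> ?Q") for f
  proof
    assume ?P
    then have f: "of_form zi wi (r + 1) V G' f" and nc: "\<not> f constant_on G'"
      and "\<exists>\<Phi>. \<forall>l\<in>{1..2*m}. (\<forall>p\<in>G'. \<Phi> l 0 p = 0) \<and>
        (\<forall>p\<in>G'. op_X m n zi wi X l f p = \<Phi> l (f p) p)"
      by (simp_all add: partial_integral_def)
    then obtain \<Phi> where \<Phi>: "\<And>l p. l \<in> {1..2*m} \<Longrightarrow> p \<in> G' \<Longrightarrow> \<Phi> l 0 p = 0"
      "\<And>l p. l \<in> {1..2*m} \<Longrightarrow> p \<in> G' \<Longrightarrow> op_X m n zi wi X l f p = \<Phi> l (f p) p"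
      by blast
    let ?\<psi>1 = "\<lambda>\<theta>. wirtinger zi wi (Z \<theta>) f" and ?\<psi>2 = "\<lambda>g. wirtinger zi wi (Zbar (j g)) f"
    let ?\<phi>1 = "gradient_w zi wi f" and ?\<phi>2 = "gradient_wbar zi wi \<zeta> f"
    let ?\<omega> = "pfaff_form zi wi s1 s2 k1 k2 j \<zeta> ?\<psi>1 ?\<psi>2 ?\<phi>1 ?\<phi>2"
    have "R_differentiable r G' (\<lambda>p. \<Phi> l (f p) p)" if l: "l \<in> {1..2*m}" for l
      using R_differentiable_op_X[where X = X and f = f and zi = zi and wi = wi and n = n, OF S _ X l] f \<Phi>(2)[OF l]
      by (subst R_differentiable_cong[OF S, of _ "op_X m n zi wi X l f"]) (simp_all add: of_form_def)
    then have adm: "admissible_unknowns m zi wi r G' s1 s2 k1 k2 V ?\<psi>1 ?\<psi>2 ?\<phi>1 ?\<phi>2 \<Phi> f"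
      using of_form_wirtinger[OF S r1 f] \<Phi>(1) by (simp add: admissible_unknowns_def)
    have E: "system_E m zi wi X G' s1 s2 k1 k2 j \<zeta> V ?\<psi>1 ?\<psi>2 ?\<phi>1 ?\<phi>2 \<Phi> f"
      using partial_integral_solves_system_E[where X = X and H = \<Phi>, OF S r V s k j \<zeta> X f \<Phi>(2)] .
    have r1': "1 \<le> r + 1" by simp
    have "(f has_derivative ?\<omega> p) (at p)" if p: "p \<in> G'" for p
      by (rule has_derivative_of_form[OF zi wi f[unfolded V] p of_form_imp_differentiable[OF f r1' p] s k j \<zeta>])
    then have "integrates zi wi r V G' ?\<omega> (\<lambda>_. 1) f"
      using f by (simp add: integrates_def of_form_const)
    then show ?Q
      using adm E nc unfolding integrating_factor_def general_integral_def by blast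
  next
    assume ?Q
    then obtain \<psi>1 \<psi>2 \<phi>1 \<phi>2 H \<mu> where
      adm: "admissible_unknowns m zi wi r G' s1 s2 k1 k2 V \<psi>1 \<psi>2 \<phi>1 \<phi>2 H f"
      and E: "system_E m zi wi X G' s1 s2 k1 k2 j \<zeta> V \<psi>1 \<psi>2 \<phi>1 \<phi>2 H f"
      and nc: "\<not> f constant_on G'"
      and "integrates zi wi r V G' (pfaff_form zi wi s1 s2 k1 k2 j \<zeta> \<psi>1 \<psi>2 \<phi>1 \<phi>2) \<mu> f"
      unfolding general_integral_def by blast
    then have f: "of_form zi wi (r + 1) V G' f"
      and df: "\<And>p. p \<in> G' \<Longrightarrow>
        (f has_derivative (\<lambda>v. \<mu> p * pfaff_form zi wi s1 s2 k1 k2 j \<zeta> \<psi>1 \<psi>2 \<phi>1 \<phi>2 p v)) (at p)"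
      by (simp_all add: integrates_def)
    have "op_X m n zi wi X l f p = \<mu> p * H l (f p) p" if "l \<in> {1..2*m}" "p \<in> G'" for l p
      using op_X_of_integral[OF inj V s k j \<zeta> E f that(2) df[OF that(2)] that(1)] .
    moreover have "\<mu> p * H l 0 p = 0" if "l \<in> {1..2*m}" "p \<in> G'" for l p
      using adm that by (simp add: admissible_unknowns_def)
    ultimately have "\<exists>\<Phi>. \<forall>l\<in>{1..2*m}. (\<forall>p\<in>G'. \<Phi> l 0 p = 0) \<and>
        (\<forall>p\<in>G'. op_X m n zi wi X l f p = \<Phi> l (f p) p)"
      by (intro exI[of _ "\<lambda>l u p. \<mu> p * H l u p"]) blast
    then show ?P
      using f nc by (simp add: partial_integral_def of_form_def)
  qed
  then show ?thesis by blast
qed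

end
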